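(* Let $\alpha\in[0,1)$. The ramified optimal allocation problem, i.e. the problem of minimizing $\mathbf{T}_\alpha(q)$ over $q\in Plan[\mathbf{x},\mathbf{b}]$, has a solution. Moreover, $$\min\{\mathbf{T}_\alpha(q):q\in Plan[\mathbf{x},\mathbf{b}]\}=\min\Big\{d_\alpha\Big(\sum_{i=1}^km_i\delta_{x_i},\mathbf{b}\Big):\vec m\in K\Big\},$$ where $K=\{\vec m=(m_1,\dots,m_k)\in\mathbb{R}_+^k:\sum_{i=1}^km_i=1\}$.
   Context: $X\subset\mathbb{R}^m$ is compact and convex, $\mathbf{x}=\{x_1,\dots,x_k\}\subset X$ is a set of $k$ points, $\mathbf{b}=\sum_{j=1}^\ell n_j\delta_{y_j}$ with $y_j\in X$, $n_j>0$, $\sum_jn_j=1$. $\mathbb{R}_+^k$ denotes vectors with nonnegative entries. Transport paths. For atomic measures $\mathbf{a},\mathbf{b}$ on $X$ of equal mass, a transport path from $\mathbf{a}$ to $\mathbf{b}$ is a weighted directed graph $G$ with a finite vertex set $V(G)$ containing all points used to write $\mathbf{a}$ and $\mathbf{b}$ (in $\sum_i m_i\delta_{x_i}$ zero masses are allowed), a finite set $E(G)$ of directed edges, each edge $e$ a line segment from $e^-$ to $e^+$, and weights $w:E(G)\to(0,\infty)$ such that for every $v\in V(G)$, $\sum_{e^-=v}w(e)=\sum_{e^+=v}w(e)+\mathbf{a}(\{v\})-\mathbf{b}(\{v\})$. By standing convention transport paths contain no cycles. $Path(\mathbf{a},\mathbf{b})$ is the set of all of them; $\mathbf{M}_\alpha(G)=\sum_{e\in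 E(G)}w(e)^\alpha\,length(e)$ and $d_\alpha(\mathbf{a},\mathbf{b})=\min\{\mathbf{M}_\alpha(G):G\in Path(\mathbf{a},\mathbf{b})\}$. Allocation plans. $Plan[\mathbf{x},\mathbf{b}]$ is the set of probability measures $q=\sum_{i,j}q_{ij}\delta_{(x_i,y_j)}$ on $X\times X$ with $q_{ij}\ge0$ and $\sum_iq_{ij}=n_j$ for all $j$. Put $\mathbf{a}(q)=\sum_i\big(\sum_jq_{ij}\big)\delta_{x_i}$. Compatibility. Given $G\in Path(\mathbf{a}(q),\mathbf{b})$, for each $(i,j)$ let $g_{ij}$ be the unique directed polyhedral curve on $G$ from $x_i$ to $y_j$ (a list of distinct vertices $v_1=x_i,\dots,v_h=y_j$ with each $[v_t,v_{t+1}]$ a directed edge of $G$) if one exists, and $g_{ij}=0$ (empty curve) otherwise. $(G,q)$ is compatible if $q_{ij}=0$ whenever $g_{ij}=0$ and $G=\sum_{i,j}q_{ij}\cdot g_{ij}$ as one-dimensional polyhedral chains. $\mathbf{T}_\alpha(q)=\min\{\mathbf{M}_\alpha(G):G\in Path(\mathbf{a}(q),\mathbf{b}),\ (G,q)\text{ compatible}\}$. *)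

theory Defs
  imports "HOL-Analysis.Analysis"
begin

text \<open>
  Points \<open>x\<^sub>1, \<dots>, x\<^sub>k\<close> are a family \<open>x\<close> over a finite index type \<open>'k\<close>, masses \<open>m\<^sub>1, \<dots>, m\<^sub>k\<close>
  a vector \<open>m :: real^'k\<close>; the pair \<open>(x, m)\<close> stands for the written-out atomic measure
  \<open>\<Sum>i. m\<^sub>i \<delta>\<close> at \<open>x\<^sub>i\<close>, in which zero masses are allowed.  Likewise \<open>(y, n)\<close> over \<open>'l\<close>.
\<close>

definition mass_at :: "('i::finite \<Rightarrow> 'a) \<Rightarrow> real^'i \<Rightarrow> 'a \<Rightarrow> real" where
  "mass_at x m v = (\<Sum>i | x i = v. m $ i)"

text \<open>
  An edge is the pair of its tail and its head, i.e. the oriented segment between them.  Parallel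
  edges need not be represented: they would form a cycle.  Only the values of \<open>weight\<close> on \<open>edges\<close>
  matter.
\<close>

record 'a wdgraph =
  verts :: "'a set"
  edges :: "('a \<times> 'a) set"
  weight :: "'a \<times> 'a \<Rightarrow> real"

definition is_wdgraph :: "'a wdgraph \<Rightarrow> bool" where
  "is_wdgraph G \<longleftrightarrow>
     finite (verts G) \<and> edges G \<subseteq> verts G \<times> verts G \<and> (\<forall>e\<in>edges G. 0 < weight G e)"

definition adjacent :: "'a wdgraph \<Rightarrow> 'a \<Rightarrow> 'a \<Rightarrow> bool" where
  "adjacent G u v \<longleftrightarrow> (u, v) \<in> edges G \<or> (v, u) \<in> edges G"

text \<open>
  Cycles are those of the underlying undirected (multi)graph, so that directed curves between two
  vertices are unique.  The three conditions exclude cycles of length 1, of length 2, and of length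
  at least 3.
\<close>

definition no_cycles :: "'a wdgraph \<Rightarrow> bool" where
  "no_cycles G \<longleftrightarrow>
     (\<forall>u. (u, u) \<notin> edges G) \<and>
     (\<forall>u v. (u, v) \<in> edges G \<longrightarrow> (v, u) \<notin> edges G) \<and>
     \<not> (\<exists>vs. 3 \<le> length vs \<and> distinct vs \<and> successively (adjacent G) vs
            \<and> adjacent G (last vs) (hd vs))"

definition transport_paths ::
  "'a set \<Rightarrow> ('k::finite \<Rightarrow> 'a) \<Rightarrow> real^'k \<Rightarrow> ('l::finite \<Rightarrow> 'a) \<Rightarrow> real^'l \<Rightarrow> 'a wdgraph set" where
  "transport_paths X x m y n =
     {G. is_wdgraph G \<and> no_cycles G \<and> verts G \<subseteq> X \<and> range x \<union> range y \<subseteq> verts G \<and>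
         (\<forall>v\<in>verts G.
            (\<Sum>e | e \<in> edges G \<and> fst e = v. weight G e)
            = (\<Sum>e | e \<in> edges G \<and> snd e = v. weight G e) + mass_at x m v - mass_at y n v)}"

definition M_cost :: "real \<Rightarrow> ('a::metric_space) wdgraph \<Rightarrow> real" where
  "M_cost \<alpha> G = (\<Sum>e\<in>edges G. weight G e powr \<alpha> * dist (fst e) (snd e))"

text \<open>
  The minimal costs below are infima in the extended reals, so that they are \<open>\<infinity>\<close> if there is no
  competitor.
\<close>

definition d_cost ::
  "real \<Rightarrow> ('a::metric_space) set \<Rightarrow> ('k::finite \<Rightarrow> 'a) \<Rightarrow> real^'k \<Rightarrow> ('l::finite \<Rightarrow> 'a) \<Rightarrow> real^'l
     \<Rightarrow> ereal" where
  "d_cost \<alpha> X x m y n = (INF G\<in>transport_paths X x m y n. ereal (M_cost \<alpha> G))"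

text \<open>
  An allocation plan is given by its coefficients \<open>q $ i $ j\<close>, the mass sent from \<open>x i\<close> to \<open>y j\<close>;
  for distinct \<open>x i\<close> and distinct \<open>y j\<close> these correspond bijectively to the measures
  \<open>\<Sum>i j. q\<^sub>i\<^sub>j \<delta>\<close> at \<open>(x\<^sub>i, y\<^sub>j)\<close>.  The total mass is 1 whenever the entries of \<open>n\<close> sum to 1.
\<close>

definition allocation_plans :: "real^'l::finite \<Rightarrow> (real^'l^'k::finite) set" where
  "allocation_plans n =
     {q. (\<forall>i j. 0 \<le> q $ i $ j) \<and> (\<forall>j. (\<Sum>i\<in>UNIV. q $ i $ j) = n $ j)}"

definition source_masses :: "real^'l::finite^'k::finite \<Rightarrow> real^'k" where
  "source_masses q = (\<chi> i. \<Sum>j\<in>UNIV. q $ i $ j)"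

definition directed_curve :: "'a wdgraph \<Rightarrow> 'a \<Rightarrow> 'a \<Rightarrow> 'a list \<Rightarrow> bool" where
  "directed_curve G u v vs \<longleftrightarrow>
     vs \<noteq> [] \<and> hd vs = u \<and> last vs = v \<and> distinct vs \<and> set vs \<subseteq> verts G \<and>
     successively (\<lambda>a b. (a, b) \<in> edges G) vs"

text \<open>
  The empty list is the empty curve, which says that there is no curve from \<open>u\<close> to \<open>v\<close>.  It differs
  from the one-vertex curve \<open>[u]\<close>, which joins \<open>u\<close> to itself and along which mass may stay in place.
\<close>

definition curve_of :: "'a wdgraph \<Rightarrow> 'a \<Rightarrow> 'a \<Rightarrow> 'a list" where
  "curve_of G u v =
     (if \<exists>vs. directed_curve G u v vs then (THE vs. directed_curve G u v vs) else [])"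

text \<open>
  A real one-dimensional polyhedral chain is identified with the current it defines, i.e. with the
  functional integrating 1-forms; a 1-form is written as a vector field \<open>F\<close>.  Two formal
  combinations of oriented segments are the same polyhedral chain (agree up to subdivision and
  orientation) iff they take the same values on all continuous \<open>F\<close>.
\<close>

type_synonym 'a chain1 = "('a \<Rightarrow> 'a) \<Rightarrow> real"

definition segment_chain :: "'a::euclidean_space \<Rightarrow> 'a \<Rightarrow> 'a chain1" where
  "segment_chain u v F = integral {0..1} (\<lambda>t. F (u + t *\<^sub>R (v - u)) \<bullet> (v - u))"

definition curve_chain :: "'a::euclidean_space list \<Rightarrow> 'a chain1" where
  "curve_chain vs F = (\<Sum>(u, v)\<leftarrow>zip vs (tl vs). segment_chain u v F)"

definition graph_chain :: "'a::euclidean_space wdgraph \<Rightarrow> 'a chain1" where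
  "graph_chain G F = (\<Sum>e\<in>edges G. weight G e * segment_chain (fst e) (snd e) F)"

definition same_chain :: "'a::euclidean_space chain1 \<Rightarrow> 'a chain1 \<Rightarrow> bool" where
  "same_chain C D \<longleftrightarrow> (\<forall>F. continuous_on UNIV F \<longrightarrow> C F = D F)"

definition compatible ::
  "('k::finite \<Rightarrow> 'a::euclidean_space) \<Rightarrow> ('l::finite \<Rightarrow> 'a) \<Rightarrow> 'a wdgraph \<Rightarrow> real^'l^'k \<Rightarrow> bool" where
  "compatible x y G q \<longleftrightarrow>
     (\<forall>i j. curve_of G (x i) (y j) = [] \<longrightarrow> q $ i $ j = 0) \<and>
     same_chain (graph_chain G)
       (\<lambda>F. \<Sum>i\<in>UNIV. \<Sum>j\<in>UNIV. q $ i $ j * curve_chain (curve_of G (x i) (y j)) F)"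

definition compatible_paths ::
  "('a::euclidean_space) set \<Rightarrow> ('k::finite \<Rightarrow> 'a) \<Rightarrow> ('l::finite \<Rightarrow> 'a) \<Rightarrow> real^'l \<Rightarrow> real^'l^'k
     \<Rightarrow> 'a wdgraph set" where
  "compatible_paths X x y n q =
     {G \<in> transport_paths X x (source_masses q) y n. compatible x y G q}"

definition T_cost ::
  "real \<Rightarrow> ('a::euclidean_space) set \<Rightarrow> ('k::finite \<Rightarrow> 'a) \<Rightarrow> ('l::finite \<Rightarrow> 'a) \<Rightarrow> real^'l
     \<Rightarrow> real^'l^'k \<Rightarrow> ereal" where
  "T_cost \<alpha> X x y n q = (INF G\<in>compatible_paths X x y n q. ereal (M_cost \<alpha> G))"

definition mass_vectors :: "(real^'k::finite) set" where
  "mass_vectors = {m. (\<forall>i. 0 \<le> m $ i) \<and> (\<Sum>i\<in>UNIV. m $ i) = 1}"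

end

theory Submission
  imports Defs
begin

text \<open>
  A transport path is encoded by the antisymmetric function \<open>\<phi> u v\<close> = flow from \<open>u\<close> to \<open>v\<close>, whose
  divergence is the difference of the two measures.  If its support contains a cycle, concavity of
  \<open>t powr \<alpha>\<close> allows one to push mass around the cycle until an edge vanishes without raising the cost;
  if an interior vertex has only two neighbours, it can be bypassed by the triangle inequality.
  Hence a flow of minimal support is a forest all of whose interior vertices have degree at least
  3, so its number of vertices is bounded by the number of given points.  The flows with boundedly
  many labelled vertices form a compact set on which the cost is lower semicontinuous, and the
  minimum over all mass vectors is attained.  Decomposing the minimizing forest into directed curves
  from sources to sinks yields an allocation plan compatible with it; so the infimum over plans,
  which is clearly at least the infimum over mass vectors, is attained with the same value.
\<close>

section \<open>Concavity of powers\<close>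

text \<open>The vertex bound alone does not give compactness: the weights must be bounded as well.
  They are at most 1 on a forest, because its flow splits into directed curves that pass each edge
  at most once and carry total mass 1. The decomposition is therefore needed twice, before the limit
  for this bound and after it for the plan. A further obstacle is that a limit of forests need not
  be a forest: vertices may collide and circuits may appear. Hence the limit is taken among flows in
  which circuits are allowed, labels at a common point are merged by subadditivity of
  \<open>t powr \<alpha>\<close>, and the reduction to a forest is applied once more. The reductions
  need not lower the cost strictly, which is why they are controlled by the size of the support. The
  masses \<open>m\<close> are part of the compact set, so one limit optimizes the masses and the
  graph together.\<close>

lemma powr_le_tangent:
  fixes a b \<alpha> :: real
  assumes "0 \<le> \<alpha>" "\<alpha> \<le> 1" "0 < a" "0 \<le> b"
  shows "b powr \<alpha> \<le> a powr \<alpha> + \<alpha> * a powr (\<alpha> - 1) * (b - a)"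
\<comment> \<open>\<open>0 powr \<alpha>\<close> is 0 also for \<open>\<alpha> = 0\<close>, so the
  bound survives the jump of the power at 0. This is the value that matters when an edge
  disappears.\<close>
proof (cases "b = 0")
  case True
  have "a powr (\<alpha> - 1) * a = a powr \<alpha>"
    using assms by (simp add: powr_diff)
  then have "a powr \<alpha> + \<alpha> * a powr (\<alpha> - 1) * (0 - a) = (1 - \<alpha>) * a powr \<alpha>"
    by (simp add: algebra_simps)
  then show ?thesis using True assms by simp
next
  case False
  with assms have b: "0 < b" by simp
  define r where "r = b / a"
  have r: "0 < r" "b = r * a" using b assms by (auto simp: r_def)
  have "r powr \<alpha> * 1 powr (1 - \<alpha>) \<le> \<alpha> * r + (1 - \<alpha>) * 1"
    using assms r by (intro Youngs_inequality_0) auto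
  then have "r powr \<alpha> \<le> 1 + \<alpha> * (r - 1)" by (simp add: algebra_simps)
  then have "a powr \<alpha> * r powr \<alpha> \<le> a powr \<alpha> * (1 + \<alpha> * (r - 1))"
    by (intro mult_left_mono) auto
  moreover have "\<alpha> * a powr (\<alpha> - 1) * (b - a) = a powr \<alpha> * (\<alpha> * (r - 1))"
    using assms r by (simp add: powr_diff field_simps)
  moreover have "b powr \<alpha> = a powr \<alpha> * r powr \<alpha>"
    using assms r by (simp add: powr_mult)
  ultimately show ?thesis by (simp add: ring_distribs)
qed

text \<open>On \<open>[0, s]\<close> the power lies above the chord through the origin, that is
  \<open>c powr \<alpha> \<ge> s powr (\<alpha> - 1) * c\<close>. The claim is the sum of two such
  bounds with \<open>s = \<bar>a\<bar> + \<bar>b\<bar>\<close>. Signs are allowed because merged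
  flows may cancel.\<close>

lemma powr_subadditive:
  fixes a b \<alpha> :: real
  assumes "0 \<le> \<alpha>" "\<alpha> \<le> 1"
  shows "\<bar>a + b\<bar> powr \<alpha> \<le> \<bar>a\<bar> powr \<alpha> + \<bar>b\<bar> powr \<alpha>"
proof (cases "a = 0 \<or> b = 0")
  case True
  then show ?thesis by auto
next
  case False
  define s where "s = \<bar>a\<bar> + \<bar>b\<bar>"
  have s: "0 < s" "\<bar>a\<bar> \<le> s" "\<bar>b\<bar> \<le> s" "\<bar>a + b\<bar> \<le> s" using False by (auto simp: s_def)
  have *: "s powr (\<alpha> - 1) * \<bar>c\<bar> \<le> \<bar>c\<bar> powr \<alpha>" if "c \<noteq> 0" "\<bar>c\<bar> \<le> s" for c
  proof -
    have "s powr (\<alpha> - 1) \<le> \<bar>c\<bar> powr (\<alpha> - 1)"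
      using that assms by (intro powr_mono2') auto
    then have "s powr (\<alpha> - 1) * \<bar>c\<bar> \<le> \<bar>c\<bar> powr (\<alpha> - 1) * \<bar>c\<bar>"
      by (intro mult_right_mono) auto
    then show ?thesis using that by (simp add: powr_diff)
  qed
  have "\<bar>a + b\<bar> powr \<alpha> \<le> s powr \<alpha>" using s assms by (intro powr_mono2) auto
  also have "\<dots> = s powr (\<alpha> - 1) * \<bar>a\<bar> + s powr (\<alpha> - 1) * \<bar>b\<bar>"
  proof -
    have "s powr \<alpha> = s powr (\<alpha> - 1) * s" using s by (simp add: powr_diff)
    also have "\<dots> = s powr (\<alpha> - 1) * (\<bar>a\<bar> + \<bar>b\<bar>)" by (simp only: s_def)
    finally show ?thesis by (simp add: distrib_left)
  qed
  also have "\<dots> \<le> \<bar>a\<bar> powr \<alpha> + \<bar>b\<bar> powr \<alpha>"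
    using False s by (intro add_mono *) auto
  finally show ?thesis .
qed

lemma powr_sum_subadditive:
  fixes f :: "'b \<Rightarrow> real"
  assumes "0 \<le> \<alpha>" "\<alpha> \<le> 1"
  shows "\<bar>\<Sum>i\<in>A. f i\<bar> powr \<alpha> \<le> (\<Sum>i\<in>A. \<bar>f i\<bar> powr \<alpha>)"
proof (induction A rule: infinite_finite_induct)
  case (insert i A)
  then show ?case
    using powr_subadditive[OF assms, of "f i" "sum f A"] by simp
qed auto

section \<open>Cycles and walks\<close>

definition has_circuit :: "('a \<Rightarrow> 'a \<Rightarrow> bool) \<Rightarrow> bool" where
  "has_circuit R \<longleftrightarrow>
     (\<exists>vs. 3 \<le> length vs \<and> distinct vs \<and> successively R vs \<and> R (last vs) (hd vs))"

lemma has_circuit_mono: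
  assumes "has_circuit R" "\<And>u v. R u v \<Longrightarrow> S u v"
  shows "has_circuit S"
  using assms unfolding has_circuit_def by (meson successively_mono)

text \<open>A successor \<open>w\<close> of the end of a longest path already lies on the path, and
  the stretch from \<open>w\<close> to the end closes up to a circuit unless it has only two
  vertices. \<open>R\<close> may be asymmetric, so this serves both for leaves of forests and for
  directed paths to a sink.\<close>

lemma longest_path:
  assumes fin: "finite V" and RV: "\<And>u v. R u v \<Longrightarrow> v \<in> V"
    and irr: "\<And>u. \<not> R u u" and nc: "\<not> has_circuit R" and a: "a \<in> V"
  obtains vs where "vs \<noteq> []" "hd vs = a" "distinct vs" "set vs \<subseteq> V" "successively R vs"
    "\<And>w. R (last vs) w \<Longrightarrow> \<exists>us. vs = us @ [w, last vs]"
proof -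
  define P where "P vs \<longleftrightarrow> vs \<noteq> [] \<and> hd vs = a \<and> distinct vs \<and> set vs \<subseteq> V \<and> successively R vs"
    for vs
  have "P [a]" using a by (simp add: P_def)
  moreover have "length vs \<le> card V" if "P vs" for vs
    using that fin card_mono[of V "set vs"] by (auto simp: P_def distinct_card)
  ultimately obtain vs where vs: "P vs" and max: "\<And>us. P us \<Longrightarrow> length us \<le> length vs"
    using ex_has_greatest_nat[of P "[a]" length "card V + 1"] by (metis le_imp_less_Suc Suc_eq_plus1)
  have "\<exists>us. vs = us @ [w, last vs]" if w: "R (last vs) w" for w
  proof -
    have "w \<in> set vs"
    proof (rule ccontr)
      assume "w \<notin> set vs"
      then have "P (vs @ [w])"
        using vs w RV[OF w] by (auto simp: P_def successively_append_iff)
      from max[OF this] show False by simp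
    qed
    then obtain ys zs where split: "vs = ys @ w # zs" by (meson split_list)
    have c: "distinct (w # zs)" "successively R (w # zs)" "R (last (w # zs)) (hd (w # zs))"
      using vs w split by (auto simp: P_def successively_append_iff)
    then have "length (w # zs) < 3"
      using nc unfolding has_circuit_def by (meson not_le)
    moreover have "zs \<noteq> []" using irr w split by auto
    ultimately obtain z where "zs = [z]" by (cases zs) auto
    then show ?thesis using split by auto
  qed
  with vs that show thesis by (auto simp: P_def)
qed

text \<open>The end of a longest path is a leaf: every neighbour of it is its predecessor. By
  symmetry the predecessor is a neighbour; for a path with one vertex \<open>b\<close> takes this
  role.\<close>

lemma leaf_exists:
  assumes fin: "finite V" and RV: "\<And>u v. R u v \<Longrightarrow> v \<in> V"
    and irr: "\<And>u. \<not> R u u" and sym: "\<And>u v. R u v \<Longrightarrow> R v u"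
    and nc: "\<not> has_circuit R" and ab: "R a b"
  obtains v p where "R v p" "\<And>w. R v w \<Longrightarrow> w = p"
proof -
  have "a \<in> V" using RV sym ab by blast
  then obtain vs where vs:
    "vs \<noteq> []" "hd vs = a" "distinct vs" "set vs \<subseteq> V" "successively R vs"
    "\<And>w. R (last vs) w \<Longrightarrow> \<exists>us. vs = us @ [w, last vs]"
    using longest_path[of V R a] fin RV irr nc by (metis (no_types, lifting))
  obtain p where p: "R (last vs) p"
  proof (cases "butlast vs" rule: rev_cases)
    case Nil
    then have "last vs = a" using vs by (metis append_butlast_last_id append_Nil list.sel(1))
    then show ?thesis using ab that by blast
  next
    case (snoc ys z)
    then have "vs = ys @ [z, last vs]"
      using vs(1) by (metis append_butlast_last_id append.assoc append_Cons append_Nil)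
    then have "R z (last vs)" using vs(5)
      by (metis successively_append_iff successively.simps(3) )
    then show ?thesis using sym that by blast
  qed
  moreover have "w = p" if w: "R (last vs) w" for w
  proof -
    obtain us us' where "vs = us @ [w, last vs]" "vs = us' @ [p, last vs]"
      using vs(6)[OF p] vs(6)[OF w] by blast
    then have "us @ [w, last vs] = us' @ [p, last vs]" by metis
    then show ?thesis by simp
  qed
  ultimately show thesis using that by blast
qed

text \<open>\<open>S\<close> contains both orders of each edge. Deleting a leaf with its edge
  removes two pairs and at least one vertex of the field; the neighbour of the leaf may drop out
  too, which only helps.\<close>

lemma card_forest_le:
  assumes "finite S" "\<And>u. (u, u) \<notin> S" "sym S" "\<not> has_circuit (\<lambda>u v. (u, v) \<in> S)"
  shows "card S \<le> 2 * card (Field S)"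
  using assms
proof (induction "card S" arbitrary: S rule: less_induct)
  case less
  show ?case
  proof (cases "S = {}")
    case False
    then obtain a b where "(a, b) \<in> S" by auto
    have fF: "finite (Field S)" using less.prems(1) by (simp add: finite_Field)
    obtain v p where v: "(v, p) \<in> S" "\<And>w. (v, w) \<in> S \<Longrightarrow> w = p"
    proof (rule leaf_exists[of "Field S" "\<lambda>u v. (u, v) \<in> S" a b])
      show "(v, u) \<in> S" if "(u, v) \<in> S" for u v using that symD[OF less.prems(3)] by blast
    qed (use less.prems(2,4) \<open>(a, b) \<in> S\<close> fF in \<open>auto simp: FieldI2\<close>)
    define S' where "S' = S - {(v, p), (p, v)}"
    have pv: "(p, v) \<in> S" "p \<noteq> v"
      using v(1) less.prems(2) symD[OF less.prems(3)] by auto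
    have card: "card S = card S' + 2"
      using v(1) pv less.prems(1) card_Diff_subset[of "{(v,p),(p,v)}" S] card_mono[of S "{(v,p),(p,v)}"]
      by (auto simp: S'_def)
    have "v \<notin> Field S'"
      using v(2) symD[OF less.prems(3)] by (fastforce simp: S'_def Field_def)
    moreover have "Field S' \<subseteq> Field S" "v \<in> Field S"
      using v(1) by (auto simp: S'_def Field_def)
    ultimately have "card (Field S') < card (Field S)"
      using fF by (intro psubset_card_mono) auto
    moreover have "card S' \<le> 2 * card (Field S')"
    proof (rule less.hyps)
      show "\<not> has_circuit (\<lambda>u v. (u, v) \<in> S')"
        using less.prems(4) by (rule contrapos_nn) (erule has_circuit_mono, simp add: S'_def)
      show "sym S'" using symD[OF less.prems(3)] by (auto simp: S'_def intro!: symI)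
    qed (use less.prems(1,2) card in \<open>auto simp: S'_def\<close>)
    ultimately show ?thesis using card by simp
  qed simp
qed

section \<open>Edge counts of walks\<close>

fun walk_count :: "'a list \<Rightarrow> 'a \<Rightarrow> 'a \<Rightarrow> real" where
  "walk_count (a # b # vs) u v = of_bool (u = a \<and> v = b) + walk_count (b # vs) u v"
| "walk_count _ u v = 0"

lemma walk_count_nonneg: "0 \<le> walk_count vs u v"
  by (induction vs u v rule: walk_count.induct) auto

lemma walk_count_notin: "u \<notin> set vs \<or> v \<notin> set vs \<Longrightarrow> walk_count vs u v = 0"
  by (induction vs u v rule: walk_count.induct) auto

lemma walk_count_01: "distinct vs \<Longrightarrow> walk_count vs u v = 0 \<or> walk_count vs u v = 1"
  by (induction vs u v rule: walk_count.induct) (auto simp: walk_count_notin)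

lemma walk_count_pos: "successively R vs \<Longrightarrow> walk_count vs u v \<noteq> 0 \<Longrightarrow> R u v"
  by (induction vs u v rule: walk_count.induct) (auto simp: of_bool_def split: if_splits)

lemma walk_count_divergence:
  assumes "finite V" "set vs \<subseteq> V" "vs \<noteq> []"
  shows "(\<Sum>u\<in>V. walk_count vs v u) - (\<Sum>u\<in>V. walk_count vs u v)
    = of_bool (v = hd vs) - of_bool (v = last vs)"
  using assms(2,3)
proof (induction vs rule: induct_list012)
  case (3 a b vs)
  have "(\<Sum>u\<in>V. of_bool (v = a \<and> u = b)) = (of_bool (v = a) :: real)"
    "(\<Sum>u\<in>V. of_bool (u = a \<and> v = b)) = (of_bool (v = b) :: real)"
    using 3(3) assms(1) by (auto simp: of_bool_def)
  with 3 show ?case by (simp add: sum.distrib)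
qed auto

lemma sum_walk_count:
  assumes "finite V" "set vs \<subseteq> V"
  shows "(\<Sum>u\<in>V. \<Sum>v\<in>V. walk_count vs u v * h u v) = (\<Sum>(u, v)\<leftarrow>zip vs (tl vs). h u v)"
  using assms(2)
proof (induction vs rule: induct_list012)
  case (3 a b vs)
  have "(\<Sum>u\<in>V. \<Sum>v\<in>V. of_bool (u = a \<and> v = b) * h u v) = (\<Sum>u\<in>V. if u = a then h a b else 0)"
    using 3(3) assms(1) by (intro sum.cong) (auto simp: of_bool_def if_distrib[of "\<lambda>t. t * _"] cong: if_cong)
  also have "\<dots> = h a b" using 3(3) assms(1) by simp
  finally show ?case using 3 by (simp add: sum.distrib ring_distribs)
qed auto

text \<open>Since the vertices are distinct, the second vertex is the only one with a nonzero count
  from the first. Cancelling this step on both sides leaves equal counts for the tails.\<close>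

lemma walk_count_inj:
  assumes "distinct vs" "distinct us" "vs \<noteq> []" "us \<noteq> []" "hd vs = hd us"
    "\<And>u v. walk_count vs u v = walk_count us u v"
  shows "vs = us"
  using assms
proof (induction vs arbitrary: us rule: induct_list012)
  case (2 a)
  show ?case
  proof (cases "(us, a, a)" rule: walk_count.cases)
    case (1 b c us')
    with 2(6)[of b c] walk_count_nonneg[of "c # us'" b c] show ?thesis by auto
  qed (use 2 in auto)
next
  case (3 a b vs)
  show ?case
  proof (cases "(us, a, a)" rule: walk_count.cases)
    case (1 a' c us')
    then have us: "us = a' # c # us'" by simp
    have a: "a' = a" using "3.prems" us by simp
    have c: "c = b"
      using "3.prems"(6)[of a b] "3.prems"(1,2) walk_count_nonneg[of "b # vs" a b] us a
      by (auto simp: walk_count_notin split: if_splits)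
    have "b # vs = c # us'"
      by (rule "3.IH"(2)) (use "3.prems" us a c in auto)
    with us a show ?thesis by simp
  qed (use "3.prems"(4) "3.prems"(6)[of a b] walk_count_nonneg[of "b # vs" a b] in auto)
qed auto

section \<open>Flows and their reduction to forests\<close>

text \<open>The sign carries the direction, so flows with a common divergence differ by elements of
  a vector space of circulations, and an edge may be reversed without a change of encoding.\<close>

definition flow_on :: "'a set \<Rightarrow> ('a \<Rightarrow> real) \<Rightarrow> ('a \<Rightarrow> 'a \<Rightarrow> real) \<Rightarrow> bool" where
  "flow_on V d \<phi> \<longleftrightarrow>
     (\<forall>u v. \<phi> v u = - \<phi> u v) \<and> (\<forall>u v. \<phi> u v \<noteq> 0 \<longrightarrow> u \<in> V) \<and> (\<forall>v\<in>V. (\<Sum>u\<in>V. \<phi> v u) = d v)"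

definition flow_supp :: "('a \<Rightarrow> 'a \<Rightarrow> real) \<Rightarrow> ('a \<times> 'a) set" where
  "flow_supp \<phi> = {(u, v). \<phi> u v \<noteq> 0}"

text \<open>Every edge is counted once in each direction, so this is twice the transport cost.\<close>

definition flow_cost :: "real \<Rightarrow> 'a::metric_space set \<Rightarrow> ('a \<Rightarrow> 'a \<Rightarrow> real) \<Rightarrow> real" where
  "flow_cost \<alpha> V \<phi> = (\<Sum>u\<in>V. \<Sum>v\<in>V. \<bar>\<phi> u v\<bar> powr \<alpha> * dist u v)"

lemma flow_onD:
  assumes "flow_on V d \<phi>"
  shows "\<phi> v u = - \<phi> u v" "\<phi> u v \<noteq> 0 \<Longrightarrow> u \<in> V" "\<phi> u v \<noteq> 0 \<Longrightarrow> v \<in> V"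
    "v \<in> V \<Longrightarrow> (\<Sum>u\<in>V. \<phi> v u) = d v" "\<phi> v v = 0"
proof -
  have a: "\<phi> v u = - \<phi> u v" for u v using assms unfolding flow_on_def by blast
  then show "\<phi> v u = - \<phi> u v" .
  show "\<phi> v v = 0" using a[of v v] by simp
  show b: "\<phi> u v \<noteq> 0 \<Longrightarrow> u \<in> V" for u v using assms unfolding flow_on_def by blast
  show "\<phi> u v \<noteq> 0 \<Longrightarrow> v \<in> V" using a[of v u] b[of v u] by simp
  show "v \<in> V \<Longrightarrow> (\<Sum>u\<in>V. \<phi> v u) = d v" using assms unfolding flow_on_def by blast
qed

lemma finite_flow_supp:
  assumes "flow_on V d \<phi>" "finite V"
  shows "finite (flow_supp \<phi>)"
proof (rule finite_subset)
  show "flow_supp \<phi> \<subseteq> V \<times> V"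
    using flow_onD(2,3)[OF assms(1)] by (auto simp: flow_supp_def)
qed (use assms in auto)

lemma flow_on_add_scaled:
  assumes "flow_on V d \<phi>" "flow_on V e \<eta>"
  shows "flow_on V (\<lambda>v. d v + t * e v) (\<lambda>u v. \<phi> u v + t * \<eta> u v)"
  unfolding flow_on_def
proof (intro conjI allI impI ballI)
  fix u v
  show "\<phi> v u + t * \<eta> v u = - (\<phi> u v + t * \<eta> u v)"
    using flow_onD(1)[OF assms(1), of v u] flow_onD(1)[OF assms(2), of v u] by simp
  show "u \<in> V" if "\<phi> u v + t * \<eta> u v \<noteq> 0"
    using that flow_onD(2)[OF assms(1), of u v] flow_onD(2)[OF assms(2), of u v] by force
next
  fix v assume "v \<in> V"
  then show "(\<Sum>u\<in>V. \<phi> v u + t * \<eta> v u) = d v + t * e v"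
    using flow_onD(4)[OF assms(1)] flow_onD(4)[OF assms(2)]
    by (simp add: sum.distrib flip: sum_distrib_left)
qed

lemma flow_on_diff:
  "flow_on V d \<phi> \<Longrightarrow> flow_on V d \<eta> \<Longrightarrow> flow_on V (\<lambda>_. 0) (\<lambda>u v. \<phi> u v - \<eta> u v)"
  using flow_on_add_scaled[of V d \<phi> d \<eta> "- 1"] by simp

lemma flow_on_uminus: "flow_on V (\<lambda>_. 0) \<eta> \<Longrightarrow> flow_on V (\<lambda>_. 0) (\<lambda>u v. - \<eta> u v)"
  using flow_on_add_scaled[of V "\<lambda>_. 0" \<eta> "\<lambda>_. 0" \<eta> "- 2"] by simp

definition walk_flow :: "'a list \<Rightarrow> 'a \<Rightarrow> 'a \<Rightarrow> real" where
  "walk_flow vs u v = walk_count vs u v - walk_count vs v u"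

lemma flow_on_walk_flow:
  assumes "finite V" "set vs \<subseteq> V" "vs \<noteq> []"
  shows "flow_on V (\<lambda>v. of_bool (v = hd vs) - of_bool (v = last vs)) (walk_flow vs)"
  unfolding flow_on_def walk_flow_def
proof (intro conjI allI impI ballI)
  fix u v
  show "u \<in> V" if "walk_count vs u v - walk_count vs v u \<noteq> 0"
    using that assms(2) walk_count_notin[of u vs v] walk_count_notin[of v vs u] by force
qed (use walk_count_divergence[OF assms] in \<open>auto simp: sum_subtractf\<close>)

text \<open>
  Along a circulation \<open>\<eta>\<close> supported in the support of \<open>\<phi>\<close> the cost is concave as long as no edge
  changes its sign, so in one of the two directions one may move without raising the cost until an
  edge disappears.
\<close>

lemma reduce_circulation:
  fixes \<phi> \<eta> :: "'a::metric_space \<Rightarrow> 'a \<Rightarrow> real"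
  assumes \<alpha>: "0 \<le> \<alpha>" "\<alpha> \<le> 1" and fin: "finite V"
    and \<phi>: "flow_on V d \<phi>" and \<eta>: "flow_on V (\<lambda>_. 0) \<eta>"
    and supp: "\<And>u v. \<eta> u v \<noteq> 0 \<Longrightarrow> \<phi> u v \<noteq> 0" and nz: "\<eta> a b \<noteq> 0"
  obtains \<psi> where "flow_on V d \<psi>" "flow_cost \<alpha> V \<psi> \<le> flow_cost \<alpha> V \<phi>" "flow_supp \<psi> \<subset> flow_supp \<phi>"
proof -
  \<comment> \<open>\<open>c u v\<close> is the derivative of the cost of the pair with respect to
    \<open>\<bar>\<phi> u v\<bar>\<close>, so \<open>L \<xi>\<close> below is the derivative of
    \<open>flow_cost\<close> at \<open>\<phi>\<close> in the direction \<open>\<xi>\<close>.\<close>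
  define c where "c u v = \<alpha> * \<bar>\<phi> u v\<bar> powr (\<alpha> - 1) * dist u v" for u v
  define L where "L \<xi> = (\<Sum>u\<in>V. \<Sum>v\<in>V. c u v * (sgn (\<phi> u v) * \<xi> u v))" for \<xi>
  have c: "0 \<le> c u v" for u v using \<alpha> by (simp add: c_def)
  have Lneg: "L (\<lambda>u v. - \<xi> u v) = - L \<xi>" for \<xi> by (simp add: L_def sum_negf)
  have Lpos: "0 \<le> L \<xi>" if "\<And>u v. 0 \<le> sgn (\<phi> u v) * \<xi> u v" for \<xi>
    unfolding L_def by (intro sum_nonneg mult_nonneg_nonneg c that)
  \<comment> \<open>The direction is \<open>\<eta>\<close> or its negative. A nonpositive derivative
    alone does not suffice: for \<open>\<alpha> = 0\<close> it vanishes identically, so some edge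
    must be required to lose mass. If \<open>\<eta>\<close> fails, its derivative is nonnegative and
    some edge gains mass along it, hence the negative succeeds.\<close>
  have "\<exists>\<xi>. flow_on V (\<lambda>_. 0) \<xi> \<and> (\<forall>u v. \<xi> u v \<noteq> 0 \<longrightarrow> \<phi> u v \<noteq> 0) \<and> L \<xi> \<le> 0 \<and>
    (\<exists>u v. sgn (\<phi> u v) * \<xi> u v < 0)"
  proof (cases "L \<eta> \<le> 0 \<and> (\<exists>u v. sgn (\<phi> u v) * \<eta> u v < 0)")
    case True
    then show ?thesis using \<eta> supp by blast
  next
    case False
    have "0 \<le> L \<eta>" using False Lpos[of \<eta>] by (meson not_le nle_le)
    moreover have "\<exists>u v. 0 < sgn (\<phi> u v) * \<eta> u v"
    proof (rule ccontr)
      assume n: "\<nexists>u v. 0 < sgn (\<phi> u v) * \<eta> u v"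
      then have "0 \<le> L (\<lambda>u v. - \<eta> u v)" by (intro Lpos) (simp add: not_less)
      then have "L \<eta> \<le> 0" by (simp add: Lneg)
      then have "sgn (\<phi> a b) * \<eta> a b = 0" using False n by (metis not_less nle_le)
      then show False using nz supp by (simp add: sgn_zero_iff)
    qed
    ultimately show ?thesis
      using flow_on_uminus[OF \<eta>] supp Lneg by (intro exI[of _ "\<lambda>u v. - \<eta> u v"]) auto
  qed
  then obtain \<xi> where \<xi>: "flow_on V (\<lambda>_. 0) \<xi>" "\<And>u v. \<xi> u v \<noteq> 0 \<Longrightarrow> \<phi> u v \<noteq> 0" "L \<xi> \<le> 0"
    and neg: "\<exists>u v. sgn (\<phi> u v) * \<xi> u v < 0" by blast
  define B where "B = {(u, v). sgn (\<phi> u v) * \<xi> u v < 0}"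
  have "B \<subseteq> flow_supp \<phi>" by (auto simp: B_def flow_supp_def)
  then have B: "finite B" "B \<noteq> {}"
    using finite_flow_supp[OF \<phi> fin] neg by (auto simp: B_def intro: finite_subset)
  \<comment> \<open>\<open>r\<close> gives the time at which a shrinking edge reaches 0, and
    \<open>t\<close> is the first such time.\<close>
  define r where "r = (\<lambda>(u, v). \<bar>\<phi> u v\<bar> / \<bar>\<xi> u v\<bar>)"
  define t where "t = Min (r ` B)"
  have "t \<in> r ` B" using B by (auto simp: t_def)
  then obtain u0 v0 where uv0: "(u0, v0) \<in> B" "t = r (u0, v0)" by auto
  have t_le: "t \<le> r e" if "e \<in> B" for e using B that by (auto simp: t_def)
  have t0: "0 \<le> t" using uv0 by (simp add: r_def)
  define \<psi> where "\<psi> u v = \<phi> u v + t * \<xi> u v" for u v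
  \<comment> \<open>No sign changes up to time \<open>t\<close>, so the absolute values are affine
    in time and the tangent bound applies to them.\<close>
  have abs: "\<bar>\<psi> u v\<bar> = \<bar>\<phi> u v\<bar> + t * (sgn (\<phi> u v) * \<xi> u v)" for u v
  proof (cases "(u, v) \<in> B")
    case True
    then have "t * \<bar>\<xi> u v\<bar> \<le> \<bar>\<phi> u v\<bar>"
      using t_le[OF True] by (auto simp: r_def B_def field_simps mult_less_0_iff)
    then show ?thesis
      using True t0 by (auto simp: B_def \<psi>_def mult_less_0_iff sgn_if split: if_splits)
  next
    case False
    then have "0 \<le> sgn (\<phi> u v) * \<xi> u v" by (auto simp: B_def)
    then show ?thesis
      using t0 \<xi>(2)[of u v] mult_nonneg_nonneg[OF t0, of "\<xi> u v"]
        mult_nonneg_nonpos[OF t0, of "\<xi> u v"]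
      by (auto simp: \<psi>_def sgn_if zero_le_mult_iff split: if_splits)
  qed
  have "\<phi> u v = 0 \<Longrightarrow> \<psi> u v = 0" for u v using \<xi>(2)[of u v] by (auto simp: \<psi>_def)
  moreover have "\<psi> u0 v0 = 0" "\<phi> u0 v0 \<noteq> 0"
    using abs[of u0 v0] uv0 by (auto simp: B_def r_def sgn_if field_simps mult_less_0_iff split: if_splits)
  ultimately have "flow_supp \<psi> \<subseteq> flow_supp \<phi>" "(u0, v0) \<in> flow_supp \<phi> - flow_supp \<psi>"
    by (auto simp: flow_supp_def)
  then have "flow_supp \<psi> \<subset> flow_supp \<phi>" by blast
  moreover have "flow_cost \<alpha> V \<psi> \<le> flow_cost \<alpha> V \<phi> + t * L \<xi>"
    unfolding flow_cost_def L_def sum_distrib_left sum.distrib[symmetric]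
  proof (intro sum_mono)
    fix u v
    show "\<bar>\<psi> u v\<bar> powr \<alpha> * dist u v
      \<le> \<bar>\<phi> u v\<bar> powr \<alpha> * dist u v + t * (c u v * (sgn (\<phi> u v) * \<xi> u v))"
    proof (cases "\<phi> u v = 0")
      case True
      then have "\<psi> u v = 0" using abs[of u v] by simp
      then show ?thesis using True by simp
    next
      case False
      have "\<bar>\<psi> u v\<bar> powr \<alpha> \<le> \<bar>\<phi> u v\<bar> powr \<alpha> + \<alpha> * \<bar>\<phi> u v\<bar> powr (\<alpha> - 1) * (\<bar>\<psi> u v\<bar> - \<bar>\<phi> u v\<bar>)"
        using False \<alpha> by (intro powr_le_tangent) auto
      then have "\<bar>\<psi> u v\<bar> powr \<alpha> * dist u v \<le>
        (\<bar>\<phi> u v\<bar> powr \<alpha> + \<alpha> * \<bar>\<phi> u v\<bar> powr (\<alpha> - 1) * (\<bar>\<psi> u v\<bar> - \<bar>\<phi> u v\<bar>)) * dist u v"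
        by (intro mult_right_mono) auto
      then show ?thesis unfolding abs c_def by (simp add: algebra_simps)
    qed
  qed
  moreover have "t * L \<xi> \<le> 0" using t0 \<xi>(3) by (rule mult_nonneg_nonpos)
  moreover have "flow_on V d \<psi>"
    unfolding \<psi>_def using flow_on_add_scaled[OF \<phi> \<xi>(1), of t] by simp
  ultimately show thesis using that by force
qed

text \<open>The two edges at \<open>v\<close> are replaced by the segment joining its two neighbours.\<close>

lemma reduce_vertex:
  fixes \<phi> :: "'a::metric_space \<Rightarrow> 'a \<Rightarrow> real"
  assumes \<alpha>: "0 \<le> \<alpha>" "\<alpha> \<le> 1" and fin: "finite V"
    and \<phi>: "flow_on V d \<phi>" and v: "v \<in> V" "d v = 0"
    and ne: "{u. \<phi> v u \<noteq> 0} \<noteq> {}" and deg: "card {u. \<phi> v u \<noteq> 0} < 3"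
  obtains \<psi> where "flow_on V d \<psi>" "flow_cost \<alpha> V \<psi> \<le> flow_cost \<alpha> V \<phi>"
    "card (flow_supp \<psi>) < card (flow_supp \<phi>)"
proof -
  note \<phi>D = flow_onD[OF \<phi>]
  let ?N = "{u. \<phi> v u \<noteq> 0}"
  have NV: "?N \<subseteq> V" using \<phi>D(3) by blast
  then have finN: "finite ?N" using fin finite_subset by blast
  have sumN: "(\<Sum>u\<in>?N. \<phi> v u) = 0"
    using \<phi>D(4)[OF v(1)] v(2) sum.mono_neutral_left[OF fin NV, of "\<phi> v"] by auto
  have "card ?N \<noteq> 1"
  proof
    assume "card ?N = 1"
    then obtain u where u: "?N = {u}" by (meson card_1_singletonE)
    then have "\<phi> v u \<noteq> 0" by blast
    with sumN u show False by simp
  qed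
  moreover have "card ?N \<noteq> 0" using finN ne by simp
  ultimately have "card ?N = 2" using deg by linarith
  then obtain u w where N: "?N = {u, w}" and uw: "u \<noteq> w" by (meson card_2_iff)
  define c where "c = \<phi> v u"
  have c: "\<phi> v u = c" "\<phi> v w = - c" "\<phi> u v = - c" "\<phi> w v = c" "c \<noteq> 0"
  proof -
    have "\<phi> v u \<noteq> 0" using N by blast
    moreover have "\<phi> v u + \<phi> v w = 0" using sumN uw unfolding N by simp
    ultimately show "\<phi> v u = c" "\<phi> v w = - c" "\<phi> u v = - c" "\<phi> w v = c" "c \<noteq> 0"
      using \<phi>D(1)[of u v] \<phi>D(1)[of w v] by (auto simp: c_def)
  qed
  have vs: "v \<noteq> u" "v \<noteq> w" "u \<in> V" "w \<in> V" using c \<phi>D(5) NV N by auto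
  \<comment> \<open>The amount \<open>c\<close> runs from \<open>w\<close> through \<open>v\<close>
    to \<open>u\<close> (backwards if \<open>c\<close> is negative). Subtracting \<open>c\<close>
    times the closed walk cancels it on both edges at \<open>v\<close> and sends it directly from
    \<open>w\<close> to \<open>u\<close>, with divergence unchanged.\<close>
  let ?D = "walk_flow [v, u, w, v]"
  define \<psi> where "\<psi> a b = \<phi> a b + (- c) * ?D a b" for a b
  have "flow_on V (\<lambda>_. 0) ?D"
    using flow_on_walk_flow[OF fin, of "[v, u, w, v]"] vs v by simp
  then have \<psi>: "flow_on V d \<psi>" using flow_on_add_scaled[OF \<phi>, of "\<lambda>_. 0" ?D "- c"] by (simp add: \<psi>_def[abs_def])
  have val: "\<psi> v u = 0" "\<psi> u v = 0" "\<psi> v w = 0" "\<psi> w v = 0"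
    "\<psi> u w = \<phi> u w + (- c)" "\<psi> w u = \<phi> w u + c"
    using c vs uw by (auto simp: \<psi>_def walk_flow_def)
  have other: "\<psi> a b = \<phi> a b"
    if "(a, b) \<notin> {(v, u), (u, v), (v, w), (w, v), (u, w), (w, u)}" for a b
  proof -
    have "successively (\<lambda>a b. (a, b) \<in> {(v, u), (u, w), (w, v)}) [v, u, w, v]" by simp
    from walk_count_pos[OF this] have "walk_count [v, u, w, v] a b = 0" "walk_count [v, u, w, v] b a = 0"
      using that by blast+
    then show ?thesis by (simp add: \<psi>_def walk_flow_def)
  qed
  \<comment> \<open>Four ordered pairs disappear and at most two appear. The new support need not be
    a subset of the old one; only its size decreases.\<close>
  have "flow_supp \<psi> \<subseteq> (flow_supp \<phi> - {(v, u), (u, v), (v, w), (w, v)}) \<union> {(u, w), (w, u)}"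
  proof (rule subrelI)
    fix a b assume ab: "(a, b) \<in> flow_supp \<psi>"
    show "(a, b) \<in> (flow_supp \<phi> - {(v, u), (u, v), (v, w), (w, v)}) \<union> {(u, w), (w, u)}"
    proof (cases "(a, b) \<in> {(v, u), (u, v), (v, w), (w, v), (u, w), (w, u)}")
      case True
      then show ?thesis using ab val by (auto simp: flow_supp_def)
    next
      case False
      then show ?thesis using ab other[OF False] by (auto simp: flow_supp_def)
    qed
  qed
  then have "card (flow_supp \<psi>)
    \<le> card ((flow_supp \<phi> - {(v, u), (u, v), (v, w), (w, v)}) \<union> {(u, w), (w, u)})"
    using finite_flow_supp[OF \<phi> fin] by (intro card_mono) auto
  also have "\<dots> \<le> card (flow_supp \<phi> - {(v, u), (u, v), (v, w), (w, v)}) + card {(u, w), (w, u)}"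
    by (rule card_Un_le)
  also have "card (flow_supp \<phi> - {(v, u), (u, v), (v, w), (w, v)}) = card (flow_supp \<phi>) - 4"
    using c vs uw by (subst card_Diff_subset) (auto simp: flow_supp_def)
  also have "card {(u, w), (w, u)} = 2" using uw by auto
  finally have le: "card (flow_supp \<psi>) \<le> card (flow_supp \<phi>) - 4 + 2" .
  have "card {(v, u), (u, v), (v, w), (w, v)} \<le> card (flow_supp \<phi>)"
    using c finite_flow_supp[OF \<phi> fin] by (intro card_mono) (auto simp: flow_supp_def)
  moreover have "card {(v, u), (u, v), (v, w), (w, v)} = 4" using vs uw by auto
  ultimately have card: "card (flow_supp \<psi>) < card (flow_supp \<phi>)" using le by linarith
  \<comment> \<open>\<open>I p q\<close> is the indicator of the undirected edge between
    \<open>p\<close> and \<open>q\<close>. Its sum over ordered pairs is 2, in accordance with the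
    double counting in \<open>flow_cost\<close>.\<close>
  define I where "I p q a b = (of_bool (a = p \<and> b = q) + of_bool (a = q \<and> b = p) :: real)"
    for p q a b :: 'a
  have sumI: "(\<Sum>a\<in>V. \<Sum>b\<in>V. I p q a b * K) = 2 * K" if "p \<in> V" "q \<in> V" for p q K
  proof -
    have "(\<Sum>a\<in>V. \<Sum>b\<in>V. I p q a b) = 2"
      using that fin by (simp add: I_def sum.distrib of_bool_conj flip: sum_distrib_left sum_distrib_right)
    then show ?thesis by (simp flip: sum_distrib_right)
  qed
  define C where "C = \<bar>c\<bar> powr \<alpha>"
  have sub: "\<bar>\<psi> u w\<bar> powr \<alpha> \<le> \<bar>\<phi> u w\<bar> powr \<alpha> + C" "\<bar>\<psi> w u\<bar> powr \<alpha> \<le> \<bar>\<phi> w u\<bar> powr \<alpha> + C"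
    unfolding val C_def using powr_subadditive[OF \<alpha>, of "\<phi> u w" "-c"] powr_subadditive[OF \<alpha>, of "\<phi> w u" c]
    by auto
  have "\<bar>\<psi> a b\<bar> powr \<alpha> * dist a b \<le> \<bar>\<phi> a b\<bar> powr \<alpha> * dist a b + I u w a b * (C * dist u w)
      - I v u a b * (C * dist v u) - I v w a b * (C * dist v w)" for a b
  proof (cases "(a, b) \<in> {(v, u), (u, v), (v, w), (w, v), (u, w), (w, u)}")
    case True
    have ne: "u \<noteq> v" "w \<noteq> v" "w \<noteq> u" using vs uw by auto
    have p: "\<bar>\<psi> u w\<bar> powr \<alpha> * dist u w \<le> \<bar>\<phi> u w\<bar> powr \<alpha> * dist u w + C * dist u w"
      "\<bar>\<psi> w u\<bar> powr \<alpha> * dist w u \<le> \<bar>\<phi> w u\<bar> powr \<alpha> * dist w u + C * dist u w"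
      using mult_right_mono[OF sub(1), of "dist u w"] mult_right_mono[OF sub(2), of "dist w u"]
      by (simp_all add: distrib_right dist_commute[of w u])
    from True consider "a = v" "b = u" | "a = u" "b = v" | "a = v" "b = w" | "a = w" "b = v"
      | "a = u" "b = w" | "a = w" "b = u" by blast
    then show ?thesis
    proof cases
      case 1 then show ?thesis using ne vs uw by (simp add: I_def C_def val(1-4) c)
    next
      case 2 then show ?thesis using ne vs uw by (simp add: I_def C_def val(1-4) c dist_commute[of u v])
    next
      case 3 then show ?thesis using ne vs uw by (simp add: I_def C_def val(1-4) c)
    next
      case 4 then show ?thesis using ne vs uw by (simp add: I_def C_def val(1-4) c dist_commute[of w v])
    next
      case 5 then show ?thesis using ne vs uw p(1) by (simp add: I_def)
    next
      case 6 then show ?thesis using ne vs uw p(2) by (simp add: I_def)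
    qed
  next
    case False
    have I0: "I p q a b = 0" if "(a, b) \<noteq> (p, q)" "(a, b) \<noteq> (q, p)" for p q
      unfolding I_def using that by (cases "a = p"; cases "a = q"; simp)
    have "I u w a b = 0" "I v u a b = 0" "I v w a b = 0" by (rule I0; use False in blast)+
    then show ?thesis by (simp add: other[OF False])
  qed
  then have "flow_cost \<alpha> V \<psi> \<le> (\<Sum>a\<in>V. \<Sum>b\<in>V. \<bar>\<phi> a b\<bar> powr \<alpha> * dist a b + I u w a b * (C * dist u w)
      - I v u a b * (C * dist v u) - I v w a b * (C * dist v w))"
    unfolding flow_cost_def by (intro sum_mono) auto
  also have "\<dots> = flow_cost \<alpha> V \<phi> + 2 * (C * dist u w) - 2 * (C * dist v u) - 2 * (C * dist v w)"
    using vs v by (simp only: flow_cost_def sum.distrib sum_subtractf sumI)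
  also have "\<dots> \<le> flow_cost \<alpha> V \<phi>"
  proof -
    have "C * dist u w \<le> C * (dist v u + dist v w)"
      using dist_triangle[of u w v] by (intro mult_left_mono) (auto simp: C_def dist_commute[of u v])
    then show ?thesis by (simp add: ring_distribs)
  qed
  finally show thesis using that \<psi> card by blast
qed

text \<open>At a leaf of the support, conservation has a single nonzero term, which is absurd. This
  yields both the uniqueness of directed curves and the fact that no mass is left over at the end of
  the decomposition.\<close>

lemma circulation_eq_0:
  assumes fin: "finite V" and \<eta>: "flow_on V (\<lambda>_. 0) \<eta>"
    and nc: "\<not> has_circuit (\<lambda>u v. \<eta> u v \<noteq> 0)"
  shows "\<eta> a b = 0"
proof (rule ccontr)
  assume ab: "\<eta> a b \<noteq> 0"
  note D = flow_onD[OF \<eta>]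
  obtain v p where p: "\<eta> v p \<noteq> 0" "\<And>w. \<eta> v w \<noteq> 0 \<Longrightarrow> w = p"
  proof (rule leaf_exists[of V "\<lambda>u v. \<eta> u v \<noteq> 0" a b])
    show "\<eta> v u \<noteq> 0" if "\<eta> u v \<noteq> 0" for u v using that D(1)[of v u] by simp
  qed (use fin D(2,3,5) nc ab in auto)
  have "(\<Sum>u\<in>V. \<eta> v u) = (\<Sum>u\<in>{p}. \<eta> v u)"
  proof (intro sum.mono_neutral_right ballI)
    show "{p} \<subseteq> V" using D(3)[OF p(1)] by simp
    show "\<eta> v w = 0" if "w \<in> V - {p}" for w using p(2)[of w] that by blast
  qed (rule fin)
  then show False using p(1) D(4)[OF D(2)[OF p(1)]] by simp
qed

text \<open>The circulation is unit mass sent once around the closed walk. Its edges are edges of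
  \<open>\<phi>\<close> in one direction or the other, which suffices because the support is
  symmetric.\<close>

lemma circulation_of_circuit:
  assumes fin: "finite V" and \<phi>: "flow_on V d \<phi>" and c: "has_circuit (\<lambda>u v. \<phi> u v \<noteq> 0)"
  obtains \<eta> a b where "flow_on V (\<lambda>_. 0) \<eta>" "\<And>u v. \<eta> u v \<noteq> 0 \<Longrightarrow> \<phi> u v \<noteq> 0" "\<eta> a b \<noteq> 0"
proof -
  note D = flow_onD[OF \<phi>]
  obtain vs where vs: "3 \<le> length vs" "distinct vs" "successively (\<lambda>u v. \<phi> u v \<noteq> 0) vs"
    "\<phi> (last vs) (hd vs) \<noteq> 0" using c unfolding has_circuit_def by blast
  obtain a b zs where ab: "vs = a # b # zs"
    using vs(1) by (cases "(vs, hd vs, hd vs)" rule: walk_count.cases) auto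
  have zs: "zs \<noteq> []" using vs(1) ab by auto
  let ?w = "b # zs @ [a]"
  have suc: "successively (\<lambda>u v. \<phi> u v \<noteq> 0) (a # ?w)"
  proof -
    have "successively (\<lambda>u v. \<phi> u v \<noteq> 0) (vs @ [hd vs])"
      using vs(3,4) ab by (subst successively_append_iff) simp
    then show ?thesis using ab by simp
  qed
  have set: "set ?w \<subseteq> V"
  proof
    fix u assume "u \<in> set ?w"
    then have "u \<in> set vs" using ab by auto
    then obtain ys ws where split: "vs = ys @ u # ws" by (meson split_list)
    show "u \<in> V"
    proof (cases ws)
      case Nil
      then show ?thesis using vs(4) split D(2) by simp
    next
      case (Cons w ws')
      then have "\<phi> u w \<noteq> 0" using vs(3) split by (simp add: successively_append_iff)
      then show ?thesis using D(2) by blast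
    qed
  qed
  have "flow_on V (\<lambda>_. 0) (walk_flow (a # ?w))"
    using flow_on_walk_flow[OF fin, of "a # ?w"] set by simp
  moreover have "\<phi> u v \<noteq> 0" if "walk_flow (a # ?w) u v \<noteq> 0" for u v
  proof -
    have "walk_count (a # ?w) u v \<noteq> 0 \<or> walk_count (a # ?w) v u \<noteq> 0"
      using that by (auto simp: walk_flow_def)
    then have "\<phi> u v \<noteq> 0 \<or> \<phi> v u \<noteq> 0" using walk_count_pos[OF suc] by blast
    then show ?thesis using D(1)[of v u] by auto
  qed
  \<comment> \<open>At least three distinct vertices are needed here: a walk \<open>a, b, a\<close>
    would cancel itself, whereas on a circuit the step from \<open>b\<close> back to
    \<open>a\<close> never occurs.\<close>
  moreover have "walk_flow (a # ?w) a b \<noteq> 0"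
  proof -
    have "walk_count ?w b a = 0"
    proof -
      have "walk_count ?w b a = walk_count (zs @ [a]) b a"
        using zs vs(2) ab by (cases zs) auto
      also have "\<dots> = 0" using vs(2) ab by (intro walk_count_notin) auto
      finally show ?thesis .
    qed
    then have "walk_count (a # ?w) b a = 0" using vs(2) ab by simp
    moreover have "0 \<le> walk_count ?w a b" by (rule walk_count_nonneg)
    ultimately show ?thesis by (simp add: walk_flow_def)
  qed
  ultimately show thesis using that by blast
qed

text \<open>Minimality is meant by cardinality of the support among the flows that cost no more than
  \<open>\<phi>\<close>. Inclusion of supports would not do, since bypassing a vertex can create a
  new edge.\<close>

lemma minimal_flow:
  fixes \<phi> :: "'a::metric_space \<Rightarrow> 'a \<Rightarrow> real"
  assumes \<alpha>: "0 \<le> \<alpha>" "\<alpha> \<le> 1" and fin: "finite V" and \<phi>: "flow_on V d \<phi>"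
  obtains \<psi> where "flow_on V d \<psi>" "flow_cost \<alpha> V \<psi> \<le> flow_cost \<alpha> V \<phi>"
    "\<not> has_circuit (\<lambda>u v. \<psi> u v \<noteq> 0)"
    "\<And>v. v \<in> V \<Longrightarrow> d v = 0 \<Longrightarrow> {u. \<psi> v u \<noteq> 0} \<noteq> {} \<Longrightarrow> 3 \<le> card {u. \<psi> v u \<noteq> 0}"
proof -
  define P where "P \<psi> \<longleftrightarrow> flow_on V d \<psi> \<and> flow_cost \<alpha> V \<psi> \<le> flow_cost \<alpha> V \<phi>" for \<psi>
  have "P \<phi>" using \<phi> by (simp add: P_def)
  then obtain \<psi> where \<psi>: "P \<psi>" and min: "\<And>\<eta>. P \<eta> \<Longrightarrow> card (flow_supp \<psi>) \<le> card (flow_supp \<eta>)"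
    using ex_has_least_nat[of P \<phi> "\<lambda>\<psi>. card (flow_supp \<psi>)"] by blast
  have flow: "flow_on V d \<psi>" and cost: "flow_cost \<alpha> V \<psi> \<le> flow_cost \<alpha> V \<phi>"
    using \<psi> by (auto simp: P_def)
  have "\<not> has_circuit (\<lambda>u v. \<psi> u v \<noteq> 0)"
  proof
    assume "has_circuit (\<lambda>u v. \<psi> u v \<noteq> 0)"
    from circulation_of_circuit[OF fin flow this] obtain \<eta> a b where
      \<eta>: "flow_on V (\<lambda>_. 0) \<eta>" "\<And>u v. \<eta> u v \<noteq> 0 \<Longrightarrow> \<psi> u v \<noteq> 0" "\<eta> a b \<noteq> 0" by metis
    from reduce_circulation[OF \<alpha> fin flow \<eta>] obtain \<psi>' where
      \<psi>': "flow_on V d \<psi>'" "flow_cost \<alpha> V \<psi>' \<le> flow_cost \<alpha> V \<psi>" "flow_supp \<psi>' \<subset> flow_supp \<psi>" by metis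
    then have "card (flow_supp \<psi>') < card (flow_supp \<psi>)"
      using finite_flow_supp[OF flow fin] by (intro psubset_card_mono)
    moreover have "P \<psi>'" using \<psi>' cost by (simp add: P_def)
    ultimately show False using min[of \<psi>'] by simp
  qed
  moreover have "3 \<le> card {u. \<psi> v u \<noteq> 0}" if v: "v \<in> V" "d v = 0" "{u. \<psi> v u \<noteq> 0} \<noteq> {}" for v
  proof (rule ccontr)
    assume "\<not> 3 \<le> card {u. \<psi> v u \<noteq> 0}"
    then have "card {u. \<psi> v u \<noteq> 0} < 3" by simp
    from reduce_vertex[OF \<alpha> fin flow v this] obtain \<psi>' where
      \<psi>': "flow_on V d \<psi>'" "flow_cost \<alpha> V \<psi>' \<le> flow_cost \<alpha> V \<psi>"
      "card (flow_supp \<psi>') < card (flow_supp \<psi>)" by metis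
    moreover have "P \<psi>'" using \<psi>' cost by (simp add: P_def)
    ultimately show False using min[of \<psi>'] by simp
  qed
  ultimately show thesis using that flow cost by blast
qed

text \<open>Double counting: the size of the support is the sum of all degrees. It is at most twice
  the number of vertices by \<open>card_forest_le\<close>, and at least three times the number of
  vertices outside \<open>T\<close>.\<close>

lemma card_Field_flow_supp_le:
  assumes fin: "finite V" and flow: "flow_on V d \<psi>" and nc: "\<not> has_circuit (\<lambda>u v. \<psi> u v \<noteq> 0)"
    and deg: "\<And>v. v \<in> V \<Longrightarrow> d v = 0 \<Longrightarrow> {u. \<psi> v u \<noteq> 0} \<noteq> {} \<Longrightarrow> 3 \<le> card {u. \<psi> v u \<noteq> 0}"
    and T: "finite T" "\<And>v. v \<in> V \<Longrightarrow> v \<notin> T \<Longrightarrow> d v = 0"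
  shows "card (Field (flow_supp \<psi>)) \<le> 3 * card T"
proof -
  let ?S = "flow_supp \<psi>"
  note D = flow_onD[OF flow]
  have finS: "finite ?S" by (rule finite_flow_supp[OF flow fin])
  have finF: "finite (Field ?S)" using finS by (rule finite_Field)
  have FV: "Field ?S \<subseteq> V" using D(2,3) by (auto simp: Field_def flow_supp_def)
  have sym: "\<psi> v u \<noteq> 0" if "\<psi> u v \<noteq> 0" for u v using D(1)[of v u] that by simp
  have "card ?S \<le> 2 * card (Field ?S)"
  proof (rule card_forest_le)
    show "sym ?S" by (rule symI) (use sym in \<open>unfold flow_supp_def, blast\<close>)
  qed (use finS D(5) nc in \<open>auto simp: flow_supp_def\<close>)
  moreover have "card ?S = (\<Sum>v\<in>Field ?S. card {u. \<psi> v u \<noteq> 0})"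
  proof -
    have "?S = Sigma (Field ?S) (\<lambda>v. {u. \<psi> v u \<noteq> 0})" by (auto simp: Field_def flow_supp_def)
    moreover have "finite {u. \<psi> v u \<noteq> 0}" for v
      using D(3) by (intro finite_subset[OF _ fin]) blast
    ultimately show ?thesis using card_SigmaI[OF finF, of "\<lambda>v. {u. \<psi> v u \<noteq> 0}"] by simp
  qed
  moreover have "(\<Sum>v\<in>Field ?S - T. 3) \<le> (\<Sum>v\<in>Field ?S - T. card {u. \<psi> v u \<noteq> 0})"
  proof (rule sum_mono)
    fix v assume v: "v \<in> Field ?S - T"
    then have "{u. \<psi> v u \<noteq> 0} \<noteq> {}" using sym unfolding Field_def flow_supp_def by blast
    then show "3 \<le> card {u. \<psi> v u \<noteq> 0}" using v FV T(2) by (intro deg) auto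
  qed
  moreover have "(\<Sum>v\<in>Field ?S - T. card {u. \<psi> v u \<noteq> 0}) \<le> (\<Sum>v\<in>Field ?S. card {u. \<psi> v u \<noteq> 0})"
    using finF by (intro sum_mono2) auto
  moreover have "card (Field ?S) - card T \<le> card (Field ?S - T)"
    by (rule diff_card_le_card_Diff[OF T(1)])
  ultimately show ?thesis by simp
qed

lemma flow_on_restrict:
  assumes fin: "finite V" and flow: "flow_on V d \<psi>" and W: "W \<subseteq> V" "Field (flow_supp \<psi>) \<subseteq> W"
  shows "flow_on W d \<psi>" "flow_cost \<alpha> W \<psi> = flow_cost \<alpha> V \<psi>"
proof -
  note D = flow_onD[OF flow]
  have out: "\<psi> u v = 0" if "u \<notin> W \<or> v \<notin> W" for u v
    using that W(2) by (auto simp: Field_def flow_supp_def)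
  show "flow_on W d \<psi>" unfolding flow_on_def
  proof (intro conjI allI impI ballI)
    show "\<psi> v u = - \<psi> u v" for u v by (rule D(1))
    show "u \<in> W" if "\<psi> u v \<noteq> 0" for u v using out that by blast
    show "(\<Sum>u\<in>W. \<psi> v u) = d v" if "v \<in> W" for v
    proof -
      have "(\<Sum>u\<in>W. \<psi> v u) = (\<Sum>u\<in>V. \<psi> v u)"
        using fin W(1) out by (intro sum.mono_neutral_left) auto
      then show ?thesis using D(4)[of v] that W(1) by auto
    qed
  qed
  have "(\<Sum>v\<in>W. \<bar>\<psi> u v\<bar> powr \<alpha> * dist u v) = (\<Sum>v\<in>V. \<bar>\<psi> u v\<bar> powr \<alpha> * dist u v)" for u
    using fin W(1) out by (intro sum.mono_neutral_left) auto
  then have "flow_cost \<alpha> W \<psi> = (\<Sum>u\<in>W. \<Sum>v\<in>V. \<bar>\<psi> u v\<bar> powr \<alpha> * dist u v)"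
    by (simp add: flow_cost_def)
  also have "\<dots> = flow_cost \<alpha> V \<psi>"
    unfolding flow_cost_def using fin W(1) out by (intro sum.mono_neutral_left) auto
  finally show "flow_cost \<alpha> W \<psi> = flow_cost \<alpha> V \<psi>" .
qed

section \<open>Flows and transport paths\<close>

definition net_mass ::
  "('k::finite \<Rightarrow> 'a) \<Rightarrow> real^'k \<Rightarrow> ('l::finite \<Rightarrow> 'a) \<Rightarrow> real^'l \<Rightarrow> 'a \<Rightarrow> real" where
  "net_mass x m y n v = mass_at x m v - mass_at y n v"

lemma mass_at_notin: "v \<notin> range x \<Longrightarrow> mass_at x m v = 0"
  by (auto simp: mass_at_def intro: sum.neutral)

lemma sum_mass_at:
  assumes "finite V" "range x \<subseteq> V"
  shows "(\<Sum>v\<in>V. mass_at x m v * g v) = (\<Sum>i\<in>UNIV. m $ i * g (x i))"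
proof -
  have "(\<Sum>v\<in>V. mass_at x m v * g v) = (\<Sum>v\<in>V. \<Sum>i | i \<in> UNIV \<and> x i = v. m $ i * g (x i))"
    by (auto simp: mass_at_def sum_distrib_right intro!: sum.cong)
  also have "\<dots> = (\<Sum>i\<in>UNIV. m $ i * g (x i))"
    by (rule sum.group) (use assms in auto)
  finally show ?thesis .
qed

text \<open>All of \<open>V\<close> is kept as vertex set, since given points that carry no flow
  must remain vertices of a transport path.\<close>

definition graph_of_flow :: "'a set \<Rightarrow> ('a \<Rightarrow> 'a \<Rightarrow> real) \<Rightarrow> 'a wdgraph" where
  "graph_of_flow V \<phi> = \<lparr>verts = V, edges = {(u, v). 0 < \<phi> u v}, weight = (\<lambda>(u, v). \<phi> u v)\<rparr>"

definition flow_of_graph :: "'a wdgraph \<Rightarrow> 'a \<Rightarrow> 'a \<Rightarrow> real" where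
  "flow_of_graph G u v =
     (if (u, v) \<in> edges G then weight G (u, v) else 0) - (if (v, u) \<in> edges G then weight G (v, u) else 0)"

lemma sum_edges_from:
  assumes "finite V" "E \<subseteq> V \<times> V"
  shows "(\<Sum>e | e \<in> E \<and> fst e = v. w e) = (\<Sum>u\<in>V. if (v, u) \<in> E then w (v, u) else 0)"
    and "(\<Sum>e | e \<in> E \<and> snd e = v. w e) = (\<Sum>u\<in>V. if (u, v) \<in> E then w (u, v) else 0)"
proof -
  have "(\<Sum>e | e \<in> E \<and> fst e = v. w e) = (\<Sum>u | u \<in> V \<and> (v, u) \<in> E. w (v, u))"
    by (rule sum.reindex_bij_witness[of _ "\<lambda>u. (v, u)" snd]) (use assms in auto)
  then show "(\<Sum>e | e \<in> E \<and> fst e = v. w e) = (\<Sum>u\<in>V. if (v, u) \<in> E then w (v, u) else 0)"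
    using assms(1) by (simp add: sum.inter_filter)
  have "(\<Sum>e | e \<in> E \<and> snd e = v. w e) = (\<Sum>u | u \<in> V \<and> (u, v) \<in> E. w (u, v))"
    by (rule sum.reindex_bij_witness[of _ "\<lambda>u. (u, v)" fst]) (use assms in auto)
  then show "(\<Sum>e | e \<in> E \<and> snd e = v. w e) = (\<Sum>u\<in>V. if (u, v) \<in> E then w (u, v) else 0)"
    using assms(1) by (simp add: sum.inter_filter)
qed

lemma sum_edges:
  assumes "finite V" "E \<subseteq> V \<times> V"
  shows "(\<Sum>e\<in>E. h e) = (\<Sum>u\<in>V. \<Sum>v\<in>V. if (u, v) \<in> E then h (u, v) else 0)"
proof -
  have "(\<Sum>e\<in>E. h e) = (\<Sum>e\<in>V \<times> V. if e \<in> E then h e else 0)"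
    using assms by (simp add: sum.If_cases Int_absorb1)
  then show ?thesis by (simp add: sum.cartesian_product case_prod_unfold cong: if_cong)
qed

lemma no_cyclesD:
  assumes "no_cycles G"
  shows "(u, u) \<notin> edges G" "(u, v) \<in> edges G \<Longrightarrow> (v, u) \<notin> edges G" "\<not> has_circuit (adjacent G)"
  using assms unfolding no_cycles_def has_circuit_def by blast+

lemma graph_of_flow_transport_path:
  assumes fin: "finite V" and flow: "flow_on V (net_mass x m y n) \<phi>"
    and nc: "\<not> has_circuit (\<lambda>u v. \<phi> u v \<noteq> 0)" and V: "V \<subseteq> X" "range x \<union> range y \<subseteq> V"
  shows "graph_of_flow V \<phi> \<in> transport_paths X x m y n"
    and "flow_cost \<alpha> V \<phi> = 2 * M_cost \<alpha> (graph_of_flow V \<phi>)"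
proof -
  let ?G = "graph_of_flow V \<phi>" and ?E = "{(u, v). 0 < \<phi> u v}"
  note D = flow_onD[OF flow]
  have EV: "?E \<subseteq> V \<times> V" using D(2,3) by (auto dest: less_imp_neq)
  have adj: "adjacent ?G u v \<longleftrightarrow> \<phi> u v \<noteq> 0" for u v
    using D(1)[of v u] by (auto simp: adjacent_def graph_of_flow_def)
  have "no_cycles ?G"
    unfolding no_cycles_def
  proof (intro conjI allI impI)
    show "(u, u) \<notin> edges ?G" for u using D(5) by (simp add: graph_of_flow_def)
    show "(v, u) \<notin> edges ?G" if "(u, v) \<in> edges ?G" for u v
      using that D(1)[of v u] by (simp add: graph_of_flow_def)
    show "\<nexists>vs. 3 \<le> length vs \<and> distinct vs \<and> successively (adjacent ?G) vs
        \<and> adjacent ?G (last vs) (hd vs)"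
      using nc unfolding has_circuit_def adj .
  qed
  moreover have "(\<Sum>e | e \<in> ?E \<and> fst e = v. case e of (u, v) \<Rightarrow> \<phi> u v)
      = (\<Sum>e | e \<in> ?E \<and> snd e = v. case e of (u, v) \<Rightarrow> \<phi> u v) + mass_at x m v - mass_at y n v"
    if v: "v \<in> V" for v
  proof -
    have "(if 0 < \<phi> v u then \<phi> v u else 0) - (if 0 < \<phi> u v then \<phi> u v else 0) = \<phi> v u" for u
      using D(1)[of u v] by auto
    then have "(\<Sum>u\<in>V. if 0 < \<phi> v u then \<phi> v u else 0) - (\<Sum>u\<in>V. if 0 < \<phi> u v then \<phi> u v else 0)
      = net_mass x m y n v"
      using D(4)[OF v] by (simp flip: sum_subtractf)
    then show ?thesis
      unfolding sum_edges_from[OF fin EV] by (simp add: net_mass_def cong: if_cong)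
  qed
  ultimately show "?G \<in> transport_paths X x m y n"
    using fin EV V by (auto simp: transport_paths_def is_wdgraph_def graph_of_flow_def)
  let ?h = "\<lambda>u v. if 0 < \<phi> u v then \<phi> u v powr \<alpha> * dist u v else 0"
  have "M_cost \<alpha> ?G = (\<Sum>u\<in>V. \<Sum>v\<in>V. ?h u v)"
    unfolding M_cost_def by (subst sum_edges[OF fin]) (use EV in \<open>simp_all add: graph_of_flow_def cong: if_cong\<close>)
  moreover from this have "M_cost \<alpha> ?G = (\<Sum>u\<in>V. \<Sum>v\<in>V. ?h v u)"
    by (subst sum.swap)
  moreover have "flow_cost \<alpha> V \<phi> = (\<Sum>u\<in>V. \<Sum>v\<in>V. ?h u v + ?h v u)"
  proof -
    have "\<bar>\<phi> u v\<bar> powr \<alpha> * dist u v = ?h u v + ?h v u" for u v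
      using D(1)[of v u] by (simp add: dist_commute)
    then show ?thesis by (simp add: flow_cost_def)
  qed
  ultimately show "flow_cost \<alpha> V \<phi> = 2 * M_cost \<alpha> ?G" by (simp add: sum.distrib)
qed

lemma flow_of_graph_transport_path:
  assumes G: "G \<in> transport_paths X x m y n"
  shows "flow_on (verts G) (net_mass x m y n) (flow_of_graph G)"
    and "flow_cost \<alpha> (verts G) (flow_of_graph G) = 2 * M_cost \<alpha> G"
proof -
  let ?\<phi> = "flow_of_graph G" and ?V = "verts G"
  have fin: "finite ?V" and EV: "edges G \<subseteq> ?V \<times> ?V" and w: "\<And>e. e \<in> edges G \<Longrightarrow> 0 < weight G e"
    and nc: "no_cycles G"
    and bal: "\<And>v. v \<in> ?V \<Longrightarrow> (\<Sum>e | e \<in> edges G \<and> fst e = v. weight G e)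
            = (\<Sum>e | e \<in> edges G \<and> snd e = v. weight G e) + mass_at x m v - mass_at y n v"
    using G by (auto simp: transport_paths_def is_wdgraph_def)
  show "flow_on ?V (net_mass x m y n) ?\<phi>"
    unfolding flow_on_def
  proof (intro conjI allI impI ballI)
    show "?\<phi> v u = - ?\<phi> u v" for u v by (simp add: flow_of_graph_def)
    show "u \<in> ?V" if "?\<phi> u v \<noteq> 0" for u v
      using that EV by (auto simp: flow_of_graph_def split: if_splits)
    show "(\<Sum>u\<in>?V. ?\<phi> v u) = net_mass x m y n v" if "v \<in> ?V" for v
      using bal[OF that] unfolding sum_edges_from[OF fin EV]
      by (simp add: flow_of_graph_def net_mass_def sum_subtractf)
  qed
  let ?h = "\<lambda>u v. if (u, v) \<in> edges G then weight G (u, v) powr \<alpha> * dist u v else 0"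
  have "M_cost \<alpha> G = (\<Sum>u\<in>?V. \<Sum>v\<in>?V. ?h u v)"
    unfolding M_cost_def by (subst sum_edges[OF fin EV]) (auto intro!: sum.cong)
  moreover from this have "M_cost \<alpha> G = (\<Sum>u\<in>?V. \<Sum>v\<in>?V. ?h v u)"
    by (subst sum.swap)
  moreover have "flow_cost \<alpha> ?V ?\<phi> = (\<Sum>u\<in>?V. \<Sum>v\<in>?V. ?h u v + ?h v u)"
  proof -
    have "\<bar>?\<phi> u v\<bar> powr \<alpha> * dist u v = ?h u v + ?h v u" for u v
      using w[of "(u, v)"] w[of "(v, u)"] no_cyclesD(2)[OF nc]
      by (auto simp: flow_of_graph_def dist_commute)
    then show ?thesis by (simp add: flow_cost_def)
  qed
  ultimately show "flow_cost \<alpha> ?V ?\<phi> = 2 * M_cost \<alpha> G" by (simp add: sum.distrib)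
qed

text \<open>Two curves with common ends define unit flows of equal divergence. Their difference is a
  circulation supported in a forest, hence 0.\<close>

lemma directed_curve_unique:
  assumes fin: "finite (verts G)" and nc: "no_cycles G"
    and vs: "directed_curve G u v vs" and us: "directed_curve G u v us"
  shows "vs = us"
proof -
  note vs' = vs[unfolded directed_curve_def] and us' = us[unfolded directed_curve_def]
  have pos: "(a, b) \<in> edges G" if "walk_count ws a b \<noteq> 0" "ws = vs \<or> ws = us" for ws a b
    using walk_count_pos[of "\<lambda>a b. (a, b) \<in> edges G" ws a b] that vs' us' by blast
  define \<eta> where "\<eta> a b = walk_flow vs a b - walk_flow us a b" for a b
  let ?d = "\<lambda>w. of_bool (w = u) - of_bool (w = v) :: real"
  have "flow_on (verts G) ?d (walk_flow vs)" "flow_on (verts G) ?d (walk_flow us)"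
    using flow_on_walk_flow[OF fin, of vs] flow_on_walk_flow[OF fin, of us] vs' us' by simp_all
  then have "flow_on (verts G) (\<lambda>_. 0) \<eta>"
    unfolding \<eta>_def[abs_def] by (rule flow_on_diff)
  then have "\<eta> a b = 0" for a b
  proof (rule circulation_eq_0[OF fin])
    show "\<not> has_circuit (\<lambda>u v. \<eta> u v \<noteq> 0)"
    proof
      assume "has_circuit (\<lambda>u v. \<eta> u v \<noteq> 0)"
      then have "has_circuit (adjacent G)"
      proof (rule has_circuit_mono)
        fix a b assume "\<eta> a b \<noteq> 0"
        then have "walk_count vs a b \<noteq> 0 \<or> walk_count vs b a \<noteq> 0 \<or>
          walk_count us a b \<noteq> 0 \<or> walk_count us b a \<noteq> 0" by (auto simp: \<eta>_def walk_flow_def)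
        then show "adjacent G a b" using pos unfolding adjacent_def by blast
      qed
      then show False using no_cyclesD(3)[OF nc] by blast
    qed
  qed
  then have eq: "walk_count vs a b - walk_count vs b a = walk_count us a b - walk_count us b a" for a b
    by (simp add: \<eta>_def walk_flow_def)
  \<comment> \<open>Only the antisymmetric parts are known to agree. Of the two orders of a pair at
    most one is an edge, so one count on each side is 0 and the counts themselves agree.\<close>
  have "walk_count vs a b = walk_count us a b" for a b
  proof (cases "(a, b) \<in> edges G")
    case True
    then have "(b, a) \<notin> edges G" using no_cyclesD(2)[OF nc] by blast
    then have "walk_count vs b a = 0" "walk_count us b a = 0" using pos by blast+
    then show ?thesis using eq[of a b] by simp
  next
    case False
    then have "walk_count vs a b = 0" "walk_count us a b = 0" using pos by blast+
    then show ?thesis by simp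
  qed
  then show ?thesis using vs' us' by (intro walk_count_inj) auto
qed

lemma curve_of_eq:
  assumes "finite (verts G)" "no_cycles G" "directed_curve G u v vs"
  shows "curve_of G u v = vs"
proof -
  have "(THE vs. directed_curve G u v vs) = vs"
    by (intro the_equality assms directed_curve_unique[OF assms(1,2) _ assms(3)])
  then show ?thesis using assms(3) by (auto simp: curve_of_def)
qed

section \<open>Decomposition into directed curves\<close>

lemma mass_at_diff_axis: "mass_at x (m - axis i t) v = mass_at x m v - t * of_bool (v = x i)"
proof -
  have "(\<Sum>k | x k = v. axis i t $ k) = (\<Sum>k | x k = v. if k = i then t else 0)"
    by (intro sum.cong) (auto simp: axis_def)
  then show ?thesis by (auto simp: mass_at_def sum_subtractf)
qed

text \<open>Nothing flows out of the end of a longest path along \<open>f\<close>, because the next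
  vertex would be the predecessor and give antiparallel edges. Whatever arrives or starts at the end
  must then be absorbed by a sink there. The path may consist of \<open>x i\<close> alone, when mass
  stays in place.\<close>

lemma path_to_sink:
  assumes G: "is_wdgraph G" "no_cycles G" and V: "range x \<union> range y \<subseteq> verts G"
    and f: "\<And>u v. 0 \<le> f u v" "\<And>u v. f u v \<noteq> 0 \<Longrightarrow> (u, v) \<in> edges G"
    and m: "\<And>i. 0 \<le> m $ i"
    and bal: "\<And>v. v \<in> verts G \<Longrightarrow>
      (\<Sum>u\<in>verts G. f v u) - (\<Sum>u\<in>verts G. f u v) = net_mass x m y n v"
    and i: "0 < m $ i"
  obtains j vs where "0 < n $ j" "directed_curve G (x i) (y j) vs" "successively (\<lambda>u v. f u v \<noteq> 0) vs"
proof -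
  let ?V = "verts G"
  have fin: "finite ?V" and EV: "edges G \<subseteq> ?V \<times> ?V" using G(1) by (auto simp: is_wdgraph_def)
  note nc = no_cyclesD[OF G(2)]
  obtain vs where vs: "vs \<noteq> []" "hd vs = x i" "distinct vs" "set vs \<subseteq> ?V" "successively (\<lambda>u v. f u v \<noteq> 0) vs"
    "\<And>w. f (last vs) w \<noteq> 0 \<Longrightarrow> \<exists>us. vs = us @ [w, last vs]"
  proof (rule longest_path[of ?V "\<lambda>u v. f u v \<noteq> 0" "x i"])
    show "v \<in> ?V" if "f u v \<noteq> 0" for u v using f(2)[OF that] EV by blast
    show "\<not> f u u \<noteq> 0" for u using f(2)[of u u] nc(1) by blast
    show "\<not> has_circuit (\<lambda>u v. f u v \<noteq> 0)"
      using nc(3) by (rule contrapos_nn) (erule has_circuit_mono, auto simp: adjacent_def dest: f(2))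
  qed (use fin V in auto)
  define v where "v = last vs"
  have v: "v \<in> ?V" using vs(1,4) by (auto simp: v_def)
  have out: "f v w = 0" for w
  proof (rule ccontr)
    assume w: "f v w \<noteq> 0"
    then obtain us where "vs = us @ [w, v]" using vs(6) v_def by blast
    then have "f w v \<noteq> 0" using vs(5) by (simp add: successively_append_iff)
    then show False using f(2) w nc(2) by blast
  qed
  have inflow: "0 \<le> (\<Sum>u\<in>?V. f u v)" using f(1) by (intro sum_nonneg)
  have mass: "0 \<le> mass_at x m v" using m by (auto simp: mass_at_def intro: sum_nonneg)
  \<comment> \<open>Something does reach the end: the mass \<open>m $ i\<close> itself if the path
    has one vertex, and otherwise the flow from the predecessor.\<close>
  have "0 < mass_at x m v + (\<Sum>u\<in>?V. f u v)"
  proof (cases "butlast vs" rule: rev_cases)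
    case Nil
    then have "v = x i" using vs(1,2) by (metis append_butlast_last_id append_Nil list.sel(1) v_def)
    then have "0 < mass_at x m v" unfolding mass_at_def using i m by (intro sum_pos2[of _ i]) auto
    then show ?thesis using inflow by simp
  next
    case (snoc ys z)
    then have split: "vs = ys @ [z, v]"
      using vs(1) by (metis append_butlast_last_id append.assoc append_Cons append_Nil v_def)
    then have "f z v \<noteq> 0" using vs(5) by (simp add: successively_append_iff)
    then have "0 < f z v" using f(1)[of z v] by simp
    then have "0 < (\<Sum>u\<in>?V. f u v)" using f(1) fin split vs(4) by (intro sum_pos2[of _ z]) auto
    then show ?thesis using mass by simp
  qed
  moreover have "mass_at y n v = mass_at x m v + (\<Sum>u\<in>?V. f u v)"
    using bal[OF v] out by (simp add: net_mass_def)
  ultimately have "0 < mass_at y n v" by simp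
  then obtain j where j: "y j = v" "0 < n $ j"
    unfolding mass_at_def by (metis (mono_tags, lifting) mem_Collect_eq not_less sum_nonpos)
  have "directed_curve G (x i) (y j) vs"
    using vs j f(2) successively_mono[OF vs(5)] by (auto simp: directed_curve_def v_def)
  then show thesis using that j vs(5) by blast
qed

text \<open>
  Sending as much mass as possible along a directed curve from a source to a sink empties the
  source, the sink or an edge.
\<close>

lemma flow_decomposition:
  fixes x :: "'k::finite \<Rightarrow> 'a" and y :: "'l::finite \<Rightarrow> 'a"
  assumes G: "is_wdgraph G" "no_cycles G" and V: "range x \<union> range y \<subseteq> verts G"
    and f: "\<And>u v. 0 \<le> f u v" "\<And>u v. f u v \<noteq> 0 \<Longrightarrow> (u, v) \<in> edges G"
    and m: "\<And>i. 0 \<le> m $ i" and n: "\<And>j. 0 \<le> n $ j"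
    and bal: "\<And>v. v \<in> verts G \<Longrightarrow>
      (\<Sum>u\<in>verts G. f v u) - (\<Sum>u\<in>verts G. f u v) = net_mass x m y n v"
  obtains q :: "real^'l^'k" where "\<And>i j. 0 \<le> q $ i $ j"
    "\<And>i. (\<Sum>j\<in>UNIV. q $ i $ j) = m $ i" "\<And>j. (\<Sum>i\<in>UNIV. q $ i $ j) = n $ j"
    "\<And>i j. q $ i $ j \<noteq> 0 \<Longrightarrow> directed_curve G (x i) (y j) (curve_of G (x i) (y j))"
    "\<And>u v. f u v = (\<Sum>i\<in>UNIV. \<Sum>j\<in>UNIV. q $ i $ j * walk_count (curve_of G (x i) (y j)) u v)"
proof -
  let ?V = "verts G"
  let ?P = "\<lambda>f m n q. (\<forall>i j. 0 \<le> q $ i $ j) \<and>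
    (\<forall>i. (\<Sum>j\<in>UNIV. q $ i $ j) = m $ i) \<and> (\<forall>j. (\<Sum>i\<in>UNIV. q $ i $ j) = n $ j) \<and>
    (\<forall>i j. q $ i $ j \<noteq> 0 \<longrightarrow> directed_curve G (x i) (y j) (curve_of G (x i) (y j))) \<and>
    (\<forall>u v. f u v = (\<Sum>i\<in>UNIV. \<Sum>j\<in>UNIV. q $ i $ j * walk_count (curve_of G (x i) (y j)) u v))"
  \<comment> \<open>The measure counts the remaining edges, sources and sinks. Only
    \<open>f\<close>, \<open>m\<close> and \<open>n\<close> shrink in the induction;
    \<open>G\<close> stays fixed, so \<open>curve_of G\<close> denotes the same curves at every
    stage.\<close>
  let ?C = "\<lambda>f m n. card {(u, v). f u v \<noteq> 0} + card {i. m $ i \<noteq> 0} + card {j. n $ j \<noteq> 0}"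
  have fin: "finite ?V" and EV: "edges G \<subseteq> ?V \<times> ?V" using G(1) by (auto simp: is_wdgraph_def)
  have "\<exists>q::real^'l^'k. ?P f m n q"
    using f m n bal
  proof (induction "?C f m n" arbitrary: f m n rule: less_induct)
    case less
    note f = less.prems(1,2) and m = less.prems(3) and n = less.prems(4) and bal = less.prems(5)
    have finf: "finite {(u, v). f u v \<noteq> 0}"
      using EV f(2) by (intro finite_subset[OF _ finite_cartesian_product[OF fin fin]]) blast
    show ?case
    proof (cases "\<exists>i. 0 < m $ i")
      case False
      then have m0: "m $ i = 0" for i using m[of i] by (auto simp: not_less intro: antisym)
      \<comment> \<open>Without sources the total balance leaves no sinks either. The antisymmetric
        part of \<open>f\<close> is then a circulation on a forest, so \<open>f u v = f v u\<close>,
        and both vanish because antiparallel edges are excluded.\<close>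
      have "(\<Sum>v\<in>?V. net_mass x m y n v) = 0"
        using bal sum.swap[of f ?V ?V] by (simp add: sum_subtractf flip: bal)
      moreover have "(\<Sum>v\<in>?V. net_mass x m y n v) = - (\<Sum>j\<in>UNIV. n $ j)"
        using sum_mass_at[OF fin, of x m "\<lambda>_. 1"] sum_mass_at[OF fin, of y n "\<lambda>_. 1"] V m0
        by (simp add: net_mass_def sum_subtractf)
      ultimately have n0: "n $ j = 0" for j using n by (simp add: sum_nonneg_eq_0_iff)
      have "f u v = 0" for u v
      proof -
        define \<eta> where "\<eta> u v = f u v - f v u" for u v
        have "flow_on ?V (\<lambda>_. 0) \<eta>" unfolding flow_on_def
        proof (intro conjI allI impI ballI)
          show "\<eta> v u = - \<eta> u v" for u v by (simp add: \<eta>_def)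
          show "u \<in> ?V" if "\<eta> u v \<noteq> 0" for u v
            using that f(2)[of u v] f(2)[of v u] EV by (cases "f u v = 0") (auto simp: \<eta>_def)
          have "mass_at x m w = 0" "mass_at y n w = 0" for w using m0 n0 by (simp_all add: mass_at_def)
          then show "(\<Sum>u\<in>?V. \<eta> w u) = 0" if "w \<in> ?V" for w
            using bal[OF that] by (simp add: \<eta>_def sum_subtractf net_mass_def)
        qed
        moreover have "\<not> has_circuit (\<lambda>u v. \<eta> u v \<noteq> 0)"
        proof
          assume "has_circuit (\<lambda>u v. \<eta> u v \<noteq> 0)"
          then have "has_circuit (adjacent G)"
          proof (rule has_circuit_mono)
            show "adjacent G a b" if "\<eta> a b \<noteq> 0" for a b
              using that f(2)[of a b] f(2)[of b a] by (cases "f a b = 0") (auto simp: \<eta>_def adjacent_def)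
          qed
          then show False using no_cyclesD(3)[OF G(2)] by blast
        qed
        ultimately have "f u v = f v u" using circulation_eq_0[OF fin, of \<eta> u v] by (simp add: \<eta>_def)
        then show ?thesis using f(2)[of u v] f(2)[of v u] no_cyclesD(2)[OF G(2), of u v] by (cases "f u v = 0") auto
      qed
      then show ?thesis using m0 n0 by (intro exI[of _ 0]) simp
    next
      case True
      then obtain i where i: "0 < m $ i" by blast
      obtain j vs where j: "0 < n $ j" and vs: "directed_curve G (x i) (y j) vs"
        and suc: "successively (\<lambda>u v. f u v \<noteq> 0) vs"
        by (rule path_to_sink[OF G V f m bal i])
      have vs': "distinct vs" "vs \<noteq> []" "set vs \<subseteq> ?V" "hd vs = x i" "last vs = y j"
        using vs by (auto simp: directed_curve_def)
      have curve: "curve_of G (x i) (y j) = vs" by (rule curve_of_eq[OF fin G(2) vs])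
      define E where "E = {(u, v). walk_count vs u v \<noteq> 0}"
      have Ef: "E \<subseteq> {(u, v). f u v \<noteq> 0}" using walk_count_pos[OF suc] by (auto simp: E_def)
      then have finE: "finite E" using finf finite_subset by blast
      \<comment> \<open>The amounts that limit how much can be sent. For a one-vertex curve
        \<open>E\<close> is empty and only the two masses remain.\<close>
      define T where "T = insert (m $ i) (insert (n $ j) ((\<lambda>(u, v). f u v) ` E))"
      define t where "t = Min T"
      have T: "finite T" "T \<noteq> {}" using finE by (auto simp: T_def)
      have "0 < s" if "s \<in> T" for s
        using that i j Ef f(1) by (auto simp: T_def less_le)
      then have t: "0 < t" using T by (simp add: t_def)
      have tle: "t \<le> m $ i" "t \<le> n $ j" "\<And>u v. (u, v) \<in> E \<Longrightarrow> t \<le> f u v"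
      proof -
        have le: "t \<le> s" if "s \<in> T" for s using T that by (simp add: t_def)
        show "t \<le> m $ i" "t \<le> n $ j" by (rule le; simp add: T_def)+
        show "t \<le> f u v" if "(u, v) \<in> E" for u v
          by (rule le) (use that in \<open>force simp: T_def\<close>)
      qed
      define f' where "f' u v = f u v - t * walk_count vs u v" for u v
      define m' where "m' = m - axis i t"
      define n' where "n' = n - axis j t"
      have wc: "walk_count vs u v = of_bool ((u, v) \<in> E)" for u v
        using walk_count_01[OF vs'(1), of u v] by (auto simp: E_def)
      have f': "0 \<le> f' u v" "f' u v \<noteq> 0 \<Longrightarrow> f u v \<noteq> 0" for u v
        using tle(3) f(1)[of u v] Ef by (auto simp: f'_def wc)
      have m': "0 \<le> m' $ k" "m' $ k \<noteq> 0 \<Longrightarrow> m $ k \<noteq> 0" for k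
        using tle(1) m[of k] i by (auto simp: m'_def axis_def split: if_splits)
      have n': "0 \<le> n' $ k" "n' $ k \<noteq> 0 \<Longrightarrow> n $ k \<noteq> 0" for k
        using tle(2) n[of k] j by (auto simp: n'_def axis_def split: if_splits)
      have sub: "{(u, v). f' u v \<noteq> 0} \<subseteq> {(u, v). f u v \<noteq> 0}" "{i. m' $ i \<noteq> 0} \<subseteq> {i. m $ i \<noteq> 0}"
        "{j. n' $ j \<noteq> 0} \<subseteq> {j. n $ j \<noteq> 0}" using f'(2) m'(2) n'(2) by blast+
      have "t \<in> T" using T by (simp add: t_def)
      then consider "t = m $ i" | "t = n $ j" | u v where "(u, v) \<in> E" "t = f u v"
        by (auto simp: T_def)
      then have less: "?C f' m' n' < ?C f m n"
      proof cases
        case 1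
        then have "i \<in> {i. m $ i \<noteq> 0} - {i. m' $ i \<noteq> 0}" using i by (simp add: m'_def)
        then have "{i. m' $ i \<noteq> 0} \<subset> {i. m $ i \<noteq> 0}" using sub(2) by blast
        then have "card {i. m' $ i \<noteq> 0} < card {i. m $ i \<noteq> 0}" by (intro psubset_card_mono) auto
        then show ?thesis using card_mono[OF finf sub(1)] card_mono[OF _ sub(3)] by auto
      next
        case 2
        then have "j \<in> {i. n $ i \<noteq> 0} - {i. n' $ i \<noteq> 0}" using j by (simp add: n'_def)
        then have "{i. n' $ i \<noteq> 0} \<subset> {i. n $ i \<noteq> 0}" using sub(3) by blast
        then have "card {i. n' $ i \<noteq> 0} < card {i. n $ i \<noteq> 0}" by (intro psubset_card_mono) auto
        then show ?thesis using card_mono[OF finf sub(1)] card_mono[OF _ sub(2)] by auto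
      next
        case (3 u v)
        then have "(u, v) \<in> {(u, v). f u v \<noteq> 0} - {(u, v). f' u v \<noteq> 0}"
          using t by (simp add: f'_def wc)
        then have "{(u, v). f' u v \<noteq> 0} \<subset> {(u, v). f u v \<noteq> 0}" using sub(1) by blast
        then have "card {(u, v). f' u v \<noteq> 0} < card {(u, v). f u v \<noteq> 0}"
          by (intro psubset_card_mono finf)
        then show ?thesis using card_mono[OF _ sub(2)] card_mono[OF _ sub(3)] by auto
      qed
      have bal': "(\<Sum>u\<in>?V. f' v u) - (\<Sum>u\<in>?V. f' u v) = net_mass x m' y n' v" if v: "v \<in> ?V" for v
      proof -
        have "(\<Sum>u\<in>?V. f' v u) - (\<Sum>u\<in>?V. f' u v) = ((\<Sum>u\<in>?V. f v u) - (\<Sum>u\<in>?V. f u v))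
          - t * ((\<Sum>u\<in>?V. walk_count vs v u) - (\<Sum>u\<in>?V. walk_count vs u v))"
          by (simp add: f'_def sum_subtractf sum_distrib_left right_diff_distrib)
        also have "\<dots> = net_mass x m y n v - t * (of_bool (v = x i) - of_bool (v = y j))"
          using bal[OF v] walk_count_divergence[OF fin vs'(3,2), of v] vs'(4,5) by simp
        also have "\<dots> = net_mass x m' y n' v"
          by (simp add: net_mass_def m'_def n'_def mass_at_diff_axis right_diff_distrib)
        finally show ?thesis .
      qed
      obtain q where q: "?P f' m' n' q"
        using less.hyps[OF less f'(1) _ m'(1) n'(1) bal'] f'(2) f(2) by blast
      define q' where "q' = q + axis i (axis j t)"
      have q': "q' $ k $ l = q $ k $ l + t * (of_bool (k = i) * of_bool (l = j))" for k l
        by (auto simp: q'_def axis_def)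
      have "?P f m n q'"
      proof (intro conjI allI impI)
        show "0 \<le> q' $ k $ l" for k l using q t by (simp add: q')
        show "(\<Sum>l\<in>UNIV. q' $ k $ l) = m $ k" for k
          using q by (simp add: q' sum.distrib m'_def axis_def flip: sum_distrib_left)
        show "(\<Sum>k\<in>UNIV. q' $ k $ l) = n $ l" for l
          using q by (simp add: q' sum.distrib n'_def axis_def flip: sum_distrib_left sum_distrib_right)
        show "directed_curve G (x k) (y l) (curve_of G (x k) (y l))" if "q' $ k $ l \<noteq> 0" for k l
        proof (cases "k = i \<and> l = j")
          case True
          then show ?thesis using vs curve by simp
        next
          case False
          then have "q $ k $ l \<noteq> 0" using that by (auto simp: q')
          then show ?thesis using q by blast
        qed
        fix u v
        let ?w = "\<lambda>k l. walk_count (curve_of G (x k) (y l)) u v"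
        have "(\<Sum>k\<in>UNIV. \<Sum>l\<in>UNIV. q' $ k $ l * ?w k l)
          = (\<Sum>k\<in>UNIV. \<Sum>l\<in>UNIV. q $ k $ l * ?w k l) +
            (\<Sum>k\<in>UNIV. \<Sum>l\<in>UNIV. t * (of_bool (k = i) * of_bool (l = j)) * ?w k l)"
          by (simp add: q' distrib_right sum.distrib)
        also have "(\<Sum>k\<in>UNIV. \<Sum>l\<in>UNIV. t * (of_bool (k = i) * of_bool (l = j)) * ?w k l)
          = (\<Sum>k\<in>UNIV. \<Sum>l\<in>UNIV. if l = j then if k = i then t * ?w i j else 0 else 0)"
          by (intro sum.cong) auto
        also have "\<dots> = t * walk_count vs u v" by (simp add: curve)
        also have "(\<Sum>k\<in>UNIV. \<Sum>l\<in>UNIV. q $ k $ l * ?w k l) = f' u v" using q by simp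
        finally show "f u v = (\<Sum>k\<in>UNIV. \<Sum>l\<in>UNIV. q' $ k $ l * ?w k l)" by (simp add: f'_def)
      qed
      then show ?thesis by blast
    qed
  qed
  then show thesis using that by blast
qed

section \<open>Compatible plans and flows of bounded size\<close>

lemma source_masses_in_mass_vectors:
  assumes "q \<in> allocation_plans n" "(\<Sum>j\<in>UNIV. n $ j) = 1"
  shows "source_masses q \<in> mass_vectors"
proof -
  have "(\<Sum>i\<in>UNIV. source_masses q $ i) = (\<Sum>j\<in>UNIV. \<Sum>i\<in>UNIV. q $ i $ j)"
    unfolding source_masses_def vec_lambda_beta by (rule sum.swap)
  also have "\<dots> = 1" using assms by (simp add: allocation_plans_def)
  finally show ?thesis
    using assms(1) by (auto simp: mass_vectors_def allocation_plans_def source_masses_def intro: sum_nonneg)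
qed

lemma sum_swap2:
  fixes h :: "'a \<Rightarrow> 'b \<Rightarrow> 'c \<Rightarrow> 'd \<Rightarrow> 'e::comm_monoid_add"
  shows "(\<Sum>u\<in>A. \<Sum>v\<in>B. \<Sum>i\<in>C. \<Sum>j\<in>D. h u v i j) = (\<Sum>i\<in>C. \<Sum>j\<in>D. \<Sum>u\<in>A. \<Sum>v\<in>B. h u v i j)"
proof -
  have 1: "(\<Sum>v\<in>B. \<Sum>i\<in>C. \<Sum>j\<in>D. h u v i j) = (\<Sum>i\<in>C. \<Sum>j\<in>D. \<Sum>v\<in>B. h u v i j)" for u
    by (subst sum.swap) (rule sum.cong[OF refl], rule sum.swap)
  show ?thesis
    unfolding 1 by (subst sum.swap) (rule sum.cong[OF refl], rule sum.swap)
qed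

text \<open>Equality of chains follows from equality of the weights on each edge, integrated along
  the segments. The bound on weights is recorded here because it depends on the decomposition: each
  curve uses an edge at most once, so a weight is at most the sum of all
  \<open>q $ i $ j\<close>.\<close>

lemma compatible_plan_exists:
  fixes x :: "'k::finite \<Rightarrow> 'a::euclidean_space" and y :: "'l::finite \<Rightarrow> 'a"
  assumes G: "G \<in> transport_paths X x m y n" and m: "m \<in> mass_vectors" and n: "\<And>j. 0 \<le> n $ j"
  obtains q where "q \<in> allocation_plans n" "source_masses q = m" "compatible x y G q"
    "\<And>e. e \<in> edges G \<Longrightarrow> weight G e \<le> 1"
proof -
  let ?V = "verts G"
  define f where "f u v = (if (u, v) \<in> edges G then weight G (u, v) else 0)" for u v
  have wd: "is_wdgraph G" and nc: "no_cycles G" and V: "range x \<union> range y \<subseteq> ?V"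
    and bal: "\<And>v. v \<in> ?V \<Longrightarrow> (\<Sum>e | e \<in> edges G \<and> fst e = v. weight G e)
            = (\<Sum>e | e \<in> edges G \<and> snd e = v. weight G e) + mass_at x m v - mass_at y n v"
    using G by (auto simp: transport_paths_def)
  have fin: "finite ?V" and EV: "edges G \<subseteq> ?V \<times> ?V" and w: "\<And>e. e \<in> edges G \<Longrightarrow> 0 < weight G e"
    using wd by (auto simp: is_wdgraph_def)
  have f: "0 \<le> f u v" "f u v \<noteq> 0 \<Longrightarrow> (u, v) \<in> edges G" for u v
    using w[of "(u, v)"] by (auto simp: f_def split: if_splits)
  have m': "0 \<le> m $ i" for i using m by (simp add: mass_vectors_def)
  have bal': "(\<Sum>u\<in>?V. f v u) - (\<Sum>u\<in>?V. f u v) = net_mass x m y n v" if "v \<in> ?V" for v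
    using bal[OF that] unfolding sum_edges_from[OF fin EV] by (simp add: f_def net_mass_def)
  let ?c = "\<lambda>i j. curve_of G (x i) (y j)"
  obtain q :: "real^'l^'k" where q: "\<And>i j. 0 \<le> q $ i $ j"
    "\<And>i. (\<Sum>j\<in>UNIV. q $ i $ j) = m $ i" "\<And>j. (\<Sum>i\<in>UNIV. q $ i $ j) = n $ j"
    "\<And>i j. q $ i $ j \<noteq> 0 \<Longrightarrow> directed_curve G (x i) (y j) (?c i j)"
    "\<And>u v. f u v = (\<Sum>i\<in>UNIV. \<Sum>j\<in>UNIV. q $ i $ j * walk_count (?c i j) u v)"
    by (rule flow_decomposition[OF wd nc V f m' n bal']) (assumption | (rule that; blast))+
  have "graph_chain G F = (\<Sum>i\<in>UNIV. \<Sum>j\<in>UNIV. q $ i $ j * curve_chain (?c i j) F)" for F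
  proof -
    let ?s = "\<lambda>u v. segment_chain u v F"
    have "graph_chain G F = (\<Sum>u\<in>?V. \<Sum>v\<in>?V. f u v * ?s u v)"
      unfolding graph_chain_def by (subst sum_edges[OF fin EV]) (auto simp: f_def intro!: sum.cong)
    also have "\<dots> = (\<Sum>u\<in>?V. \<Sum>v\<in>?V. \<Sum>i\<in>UNIV. \<Sum>j\<in>UNIV. q $ i $ j * walk_count (?c i j) u v * ?s u v)"
      by (simp add: q(5) sum_distrib_right)
    also have "\<dots> = (\<Sum>i\<in>UNIV. \<Sum>j\<in>UNIV. \<Sum>u\<in>?V. \<Sum>v\<in>?V. q $ i $ j * walk_count (?c i j) u v * ?s u v)"
      by (rule sum_swap2)
    also have "\<dots> = (\<Sum>i\<in>UNIV. \<Sum>j\<in>UNIV. q $ i $ j * curve_chain (?c i j) F)"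
    proof (intro sum.cong refl)
      fix i j
      have "(\<Sum>u\<in>?V. \<Sum>v\<in>?V. q $ i $ j * walk_count (?c i j) u v * ?s u v)
        = q $ i $ j * (\<Sum>u\<in>?V. \<Sum>v\<in>?V. walk_count (?c i j) u v * ?s u v)"
        by (simp add: sum_distrib_left mult.assoc)
      also have "\<dots> = q $ i $ j * curve_chain (?c i j) F"
      proof (cases "q $ i $ j = 0")
        case False
        then have "set (?c i j) \<subseteq> ?V" using q(4)[of i j] by (auto simp: directed_curve_def)
        then show ?thesis by (simp add: sum_walk_count[OF fin] curve_chain_def)
      qed simp
      finally show "(\<Sum>u\<in>?V. \<Sum>v\<in>?V. q $ i $ j * walk_count (?c i j) u v * ?s u v)
        = q $ i $ j * curve_chain (?c i j) F" .
    qed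
    finally show ?thesis .
  qed
  moreover have "q $ i $ j = 0" if "?c i j = []" for i j
    using q(4)[of i j] that by (auto simp: directed_curve_def)
  ultimately have "compatible x y G q" by (auto simp: compatible_def same_chain_def)
  moreover have "weight G e \<le> 1" if e: "e \<in> edges G" for e
  proof -
    obtain u v where uv: "e = (u, v)" by (cases e)
    have "weight G e = (\<Sum>i\<in>UNIV. \<Sum>j\<in>UNIV. q $ i $ j * walk_count (?c i j) u v)"
      using q(5)[of u v] e uv by (simp add: f_def)
    also have "\<dots> \<le> (\<Sum>i\<in>UNIV. \<Sum>j\<in>UNIV. q $ i $ j)"
    proof (intro sum_mono)
      fix i j
      show "q $ i $ j * walk_count (?c i j) u v \<le> q $ i $ j"
      proof (cases "q $ i $ j = 0")
        case False
        then have "walk_count (?c i j) u v \<le> 1"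
          using q(4)[of i j] by (auto simp: directed_curve_def dest: walk_count_01[of _ u v])
        then show ?thesis using q(1)[of i j] by (simp add: mult_left_le)
      qed simp
    qed
    also have "\<dots> = 1" using m by (simp add: q(2) mass_vectors_def)
    finally show ?thesis .
  qed
  moreover have "q \<in> allocation_plans n" using q by (simp add: allocation_plans_def)
  moreover have "source_masses q = m" using q by (simp add: source_masses_def vec_eq_iff)
  ultimately show thesis using that by blast
qed

text \<open>With \<open>N = CARD('k) + CARD('l)\<close>, the vertices met by the reduced flow number
  at most \<open>3 * N\<close>, and adding all given points, some possibly isolated, gives
  \<open>4 * N\<close>.\<close>

lemma bounded_flow_exists:
  fixes x :: "'k::finite \<Rightarrow> 'a::euclidean_space" and y :: "'l::finite \<Rightarrow> 'a"
  assumes \<alpha>: "0 \<le> \<alpha>" "\<alpha> \<le> 1"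
    and G: "G \<in> transport_paths X x m y n" and m: "m \<in> mass_vectors" and n: "\<And>j. 0 \<le> n $ j"
  obtains V \<phi> where "finite V" "V \<subseteq> X" "range x \<union> range y \<subseteq> V"
    "card V \<le> 4 * (CARD('k) + CARD('l))" "flow_on V (net_mass x m y n) \<phi>"
    "\<And>u v. \<bar>\<phi> u v\<bar> \<le> 1" "flow_cost \<alpha> V \<phi> \<le> 2 * M_cost \<alpha> G"
proof -
  let ?V = "verts G" and ?d = "net_mass x m y n" and ?T = "range x \<union> range y"
  have fin: "finite ?V" and TV: "?T \<subseteq> ?V" and VX: "?V \<subseteq> X"
    using G by (auto simp: transport_paths_def is_wdgraph_def)
  obtain \<psi> where flow: "flow_on ?V ?d \<psi>"
    and cost: "flow_cost \<alpha> ?V \<psi> \<le> flow_cost \<alpha> ?V (flow_of_graph G)"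
    and nc: "\<not> has_circuit (\<lambda>u v. \<psi> u v \<noteq> 0)"
    and deg: "\<And>v. v \<in> ?V \<Longrightarrow> ?d v = 0 \<Longrightarrow> {u. \<psi> v u \<noteq> 0} \<noteq> {} \<Longrightarrow> 3 \<le> card {u. \<psi> v u \<noteq> 0}"
    using minimal_flow[OF \<alpha> fin flow_of_graph_transport_path(1)[OF G]] by blast
  define W where "W = Field (flow_supp \<psi>) \<union> ?T"
  have FV: "Field (flow_supp \<psi>) \<subseteq> ?V"
    using flow_onD(2,3)[OF flow] by (auto simp: Field_def flow_supp_def)
  have W: "W \<subseteq> ?V" "Field (flow_supp \<psi>) \<subseteq> W" using FV TV by (auto simp: W_def)
  have finW: "finite W" using W(1) fin finite_subset by blast
  note flowW = flow_on_restrict[OF fin flow W]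
  have cardT: "card ?T \<le> CARD('k) + CARD('l)"
    using card_Un_le[of "range x" "range y"] card_image_le[of UNIV x] card_image_le[of UNIV y] by simp
  have "card (Field (flow_supp \<psi>)) \<le> 3 * card ?T"
  proof (rule card_Field_flow_supp_le[OF fin flow nc deg])
    show "?d v = 0" if "v \<notin> ?T" for v using that by (simp add: net_mass_def mass_at_notin)
  qed auto
  then have cardW: "card W \<le> 4 * (CARD('k) + CARD('l))"
    using card_Un_le[of "Field (flow_supp \<psi>)" ?T] cardT by (simp add: W_def)
  have TW: "?T \<subseteq> W" by (simp add: W_def)
  have WX: "W \<subseteq> X" using W VX by blast
  note G' = graph_of_flow_transport_path(1)[OF finW flowW(1) nc WX TW]
  \<comment> \<open>The reduced flow is turned into a transport path, whose weights are bounded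
    through a compatible plan.\<close>
  have le1: "\<psi> u v \<le> 1" for u v
  proof (cases "0 < \<psi> u v")
    case True
    obtain q where "\<And>e. e \<in> edges (graph_of_flow W \<psi>) \<Longrightarrow> weight (graph_of_flow W \<psi>) e \<le> 1"
      using compatible_plan_exists[OF G' m n] by blast
    from this[of "(u, v)"] True show ?thesis by (simp add: graph_of_flow_def)
  qed simp
  then have "\<bar>\<psi> u v\<bar> \<le> 1" for u v
    using le1[of u v] le1[of v u] flow_onD(1)[OF flow, of v u] by (simp add: abs_le_iff)
  moreover have "flow_cost \<alpha> W \<psi> \<le> 2 * M_cost \<alpha> G"
    using cost flowW(2)[of \<alpha>] flow_of_graph_transport_path(2)[OF G, of \<alpha>] by simp
  ultimately show thesis using that finW WX TW cardW flowW(1) by blast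
qed

section \<open>Compactness\<close>

text \<open>
  In a labelled flow the points \<open>p $ a\<close> may coincide, so that the labelled flows form a compact set.
  Conservation of mass is tested against continuous functions, which makes it closed under limits.
\<close>

definition labelled_flows ::
  "'a::euclidean_space set \<Rightarrow> ('k::finite \<Rightarrow> 'a) \<Rightarrow> ('l::finite \<Rightarrow> 'a) \<Rightarrow> real^'l
     \<Rightarrow> ((real^'k) \<times> ('a^'r::finite) \<times> (real^'r^'r)) set" where
  "labelled_flows X x y n =
     {z. fst z \<in> mass_vectors \<and> (\<forall>a. fst (snd z) $ a \<in> X) \<and> (\<forall>a b. \<bar>snd (snd z) $ a $ b\<bar> \<le> 1) \<and>
        (\<forall>a b. snd (snd z) $ b $ a = - (snd (snd z) $ a $ b)) \<and>
        (\<forall>g. continuous_on UNIV g \<longrightarrow> (\<Sum>a\<in>UNIV. \<Sum>b\<in>UNIV. snd (snd z) $ a $ b * g (fst (snd z) $ a))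
           = (\<Sum>i\<in>UNIV. fst z $ i * g (x i)) - (\<Sum>j\<in>UNIV. n $ j * g (y j)))}"

definition labelled_cost :: "real \<Rightarrow> 'a::euclidean_space^'r::finite \<Rightarrow> real^'r^'r \<Rightarrow> real" where
  "labelled_cost \<alpha> p w = (\<Sum>a\<in>UNIV. \<Sum>b\<in>UNIV. \<bar>w $ a $ b\<bar> powr \<alpha> * dist (p $ a) (p $ b))"

lemma labelled_flowsD:
  assumes "(m, p, w) \<in> labelled_flows X x y n"
  shows "m \<in> mass_vectors" "p $ a \<in> X" "\<bar>w $ a $ b\<bar> \<le> 1" "w $ b $ a = - (w $ a $ b)"
    "continuous_on UNIV g \<Longrightarrow> (\<Sum>a\<in>UNIV. \<Sum>b\<in>UNIV. w $ a $ b * g (p $ a))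
      = (\<Sum>i\<in>UNIV. m $ i * g (x i)) - (\<Sum>j\<in>UNIV. n $ j * g (y j))"
  using assms unfolding labelled_flows_def mem_Collect_eq fst_conv snd_conv by blast+

lemma norm_vec_le_sum: "norm (v :: 'a::real_normed_vector^'r::finite) \<le> (\<Sum>a\<in>UNIV. norm (v $ a))"
  unfolding norm_vec_def by (rule L2_set_le_sum) simp

lemma bounded_vec:
  assumes "\<And>v a. v \<in> S \<Longrightarrow> norm (v $ a) \<le> K"
  shows "bounded (S :: ('a::real_normed_vector^'r::finite) set)"
proof (rule boundedI)
  fix v assume "v \<in> S"
  then have "(\<Sum>a\<in>UNIV. norm (v $ a)) \<le> (\<Sum>a\<in>(UNIV :: 'r set). K)"
    by (intro sum_mono assms)
  then show "norm v \<le> real CARD('r) * K" using norm_vec_le_sum[of v] by simp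
qed

lemma compact_labelled_flows:
  fixes X :: "'a::euclidean_space set"
  assumes X: "compact X"
  shows "compact (labelled_flows X x y n :: ((real^'k::finite) \<times> ('a^'r::finite) \<times> (real^'r^'r)) set)"
    (is "compact ?Z")
proof -
  obtain K where K: "\<And>z. z \<in> X \<Longrightarrow> norm z \<le> K"
    using compact_imp_bounded[OF X] by (auto simp: bounded_iff)
  have "bounded (mass_vectors :: (real^'k) set)"
  proof (rule bounded_vec)
    fix m :: "real^'k" and i assume m: "m \<in> mass_vectors"
    then have "m $ i \<le> (\<Sum>i\<in>UNIV. m $ i)" by (intro member_le_sum) (auto simp: mass_vectors_def)
    then show "norm (m $ i) \<le> 1" using m by (auto simp: mass_vectors_def)
  qed
  moreover have "bounded {p :: 'a^'r. \<forall>a. p $ a \<in> X}" using K by (intro bounded_vec) auto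
  moreover have "bounded {w :: real^'r^'r. \<forall>a b. \<bar>w $ a $ b\<bar> \<le> 1}"
  proof (rule bounded_vec)
    fix w :: "real^'r^'r" and a assume "w \<in> {w. \<forall>a b. \<bar>w $ a $ b\<bar> \<le> 1}"
    then have "(\<Sum>b\<in>UNIV. norm (w $ a $ b)) \<le> (\<Sum>b\<in>(UNIV :: 'r set). 1)" by (intro sum_mono) auto
    then show "norm (w $ a) \<le> real CARD('r)" using norm_vec_le_sum[of "w $ a"] by simp
  qed
  ultimately have "bounded (mass_vectors \<times> {p :: 'a^'r. \<forall>a. p $ a \<in> X} \<times>
      {w :: real^'r^'r. \<forall>a b. \<bar>w $ a $ b\<bar> \<le> 1} :: ((real^'k) \<times> ('a^'r) \<times> (real^'r^'r)) set)"
    by (intro bounded_Times)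
  then have "bounded ?Z"
    by (rule bounded_subset) (use labelled_flowsD(1-3) in \<open>fastforce simp del: split_paired_All\<close>)
  moreover have "closed ?Z"
  proof -
    have pos: "closed {z :: (real^'k) \<times> ('a^'r) \<times> (real^'r^'r). fst (snd z) $ a \<in> X}" for a
      using continuous_closed_vimage[OF compact_imp_closed[OF X],
          of "\<lambda>z :: (real^'k) \<times> ('a^'r) \<times> (real^'r^'r). fst (snd z) $ a"]
      by (simp add: vimage_def continuous_intros)
    have bal: "closed {z :: (real^'k) \<times> ('a^'r) \<times> (real^'r^'r). continuous_on UNIV g \<longrightarrow>
        (\<Sum>a\<in>UNIV. \<Sum>b\<in>UNIV. snd (snd z) $ a $ b * g (fst (snd z) $ a))
          = (\<Sum>i\<in>UNIV. fst z $ i * g (x i)) - (\<Sum>j\<in>UNIV. n $ j * g (y j))}" for g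
    proof (cases "continuous_on UNIV g")
      case True
      have "continuous_on UNIV (\<lambda>z :: (real^'k) \<times> ('a^'r) \<times> (real^'r^'r). g (fst (snd z) $ a))" for a
        by (rule continuous_on_compose2[OF True]) (auto intro!: continuous_intros)
      then show ?thesis using True by (auto intro!: closed_Collect_eq continuous_intros)
    qed simp
    show ?thesis
      unfolding labelled_flows_def mass_vectors_def mem_Collect_eq
      by (intro closed_Collect_conj closed_Collect_all closed_Collect_le
          closed_Collect_eq continuous_intros pos bal)
  qed
  ultimately show ?thesis by (simp add: compact_eq_bounded_closed)
qed

text \<open>
  The cost is only lower semicontinuous, since \<open>\<bar>w\<bar> powr 0\<close> jumps at \<open>w = 0\<close>.  The part of it that
  belongs to the edges of the limit is continuous there.
\<close>

lemma labelled_minimum: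
  fixes X :: "'a::euclidean_space set" and x :: "'k::finite \<Rightarrow> 'a"
  assumes X: "compact X"
    and ne: "(labelled_flows X x y n :: ((real^'k) \<times> ('a^'r::finite) \<times> (real^'r^'r)) set) \<noteq> {}"
  obtains m p w where "(m, p, w) \<in> (labelled_flows X x y n :: ((real^'k) \<times> ('a^'r) \<times> (real^'r^'r)) set)"
    "\<And>m' p' w'. (m', p', w') \<in> (labelled_flows X x y n :: ((real^'k) \<times> ('a^'r) \<times> (real^'r^'r)) set)
       \<Longrightarrow> labelled_cost \<alpha> p w \<le> labelled_cost \<alpha> p' w'"
proof -
  let ?Z = "labelled_flows X x y n :: ((real^'k) \<times> ('a^'r) \<times> (real^'r^'r)) set"
  define C where "C z = labelled_cost \<alpha> (fst (snd z)) (snd (snd z))"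
    for z :: "(real^'k) \<times> ('a^'r) \<times> (real^'r^'r)"
  have C0: "0 \<le> C z" for z unfolding C_def labelled_cost_def by (intro sum_nonneg) auto
  define c where "c = Inf (C ` ?Z)"
  have bdd: "bdd_below (C ` ?Z)" using C0 by (intro bdd_belowI[of _ 0]) auto
  have "\<exists>z\<in>?Z. C z < c + 1 / real (Suc s)" for s
    using cInf_lessD[of "C ` ?Z" "c + 1 / real (Suc s)"] ne by (auto simp: c_def)
  then obtain z where z: "\<And>s. z s \<in> ?Z" "\<And>s. C (z s) < c + 1 / real (Suc s)" by metis
  have "seq_compact ?Z" using compact_labelled_flows[OF X] by (simp add: compact_eq_seq_compact_metric)
  then obtain l r where l: "l \<in> ?Z" "strict_mono r" "(z \<circ> r) \<longlonglongrightarrow> l"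
    using z(1) unfolding seq_compact_def by blast
  define p where "p = fst (snd l)"
  define w where "w = snd (snd l)"
  define D where "D v = (\<Sum>a\<in>UNIV. \<Sum>b\<in>UNIV. if w $ a $ b = 0 then 0 else
      \<bar>snd (snd v) $ a $ b\<bar> powr \<alpha> * dist (fst (snd v) $ a) (fst (snd v) $ b))"
    for v :: "(real^'k) \<times> ('a^'r) \<times> (real^'r^'r)"
  have zr: "(\<lambda>s. z (r s)) \<longlonglongrightarrow> l" using l(3) by (simp add: o_def)
  have "(\<lambda>s. D (z (r s))) \<longlonglongrightarrow> D l"
    unfolding D_def
  proof (intro tendsto_sum)
    fix a b
    show "(\<lambda>s. if w $ a $ b = 0 then 0 else \<bar>snd (snd (z (r s))) $ a $ b\<bar> powr \<alpha> *
        dist (fst (snd (z (r s))) $ a) (fst (snd (z (r s))) $ b))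
      \<longlonglongrightarrow> (if w $ a $ b = 0 then 0 else \<bar>snd (snd l) $ a $ b\<bar> powr \<alpha> *
        dist (fst (snd l) $ a) (fst (snd l) $ b))"
    proof (cases "w $ a $ b = 0")
      case False
      then have "\<bar>snd (snd l) $ a $ b\<bar> \<noteq> 0" by (simp add: w_def)
      then show ?thesis using False zr by (auto intro!: tendsto_intros)
    qed simp
  qed
  \<comment> \<open>The pairs dropped from \<open>D\<close> have weight 0 in the limit and cost
    nothing there, as \<open>0 powr \<alpha> = 0\<close> for every \<open>\<alpha>\<close>.\<close>
  moreover have "D l = C l"
    unfolding D_def C_def labelled_cost_def w_def by (intro sum.cong) auto
  moreover have DC: "D v \<le> C v" for v
    unfolding D_def C_def labelled_cost_def by (intro sum_mono) auto
  moreover have "(\<lambda>s. c + 1 / real (Suc (r s))) \<longlonglongrightarrow> c"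
  proof -
    have "(\<lambda>s. 1 / real (Suc (r s))) \<longlonglongrightarrow> 0"
      using LIMSEQ_subseq_LIMSEQ[OF lim_1_over_n[THEN LIMSEQ_Suc] l(2)] by (simp add: o_def)
    then show ?thesis using tendsto_add[OF tendsto_const[of c]] by force
  qed
  ultimately have "C l \<le> c"
    by (intro LIMSEQ_le[of "\<lambda>s. D (z (r s))" _ "\<lambda>s. c + 1 / real (Suc (r s))"])
      (assumption | (intro exI[of _ 0] allI impI order_trans[OF DC less_imp_le[OF z(2)]]) | simp)+
  then have "C l \<le> C v" if "v \<in> ?Z" for v
    using cInf_lower[OF imageI[OF that] bdd] by (simp add: c_def)
  then show thesis using that[of "fst l" p w] l(1) by (fastforce simp: C_def p_def w_def)
qed

section \<open>Passing between flows and labelled flows\<close>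

lemma separating_function:
  fixes v :: "'a::metric_space"
  assumes "finite V"
  obtains g :: "'a \<Rightarrow> real" where "continuous_on UNIV g" "\<And>u. u \<in> V \<Longrightarrow> g u = of_bool (u = v)"
\<comment> \<open>The test function is the normalized distance to the other points. With no other
  points \<open>infdist\<close> has the default value 0, so a constant is used instead.\<close>
proof (cases "V - {v} = {}")
  case True
  then show ?thesis using that[of "\<lambda>_. 1"] by auto
next
  case False
  let ?h = "\<lambda>u. infdist u (V - {v})"
  have "closed (V - {v})" using assms by (intro finite_imp_closed) auto
  then have "?h v \<noteq> 0" using in_closed_iff_infdist_zero[OF _ False, of v] by auto
  moreover have "?h u = 0" if "u \<in> V" "u \<noteq> v" for u using that by (intro infdist_zero) auto
  ultimately show ?thesis
    by (intro that[of "\<lambda>u. ?h u / ?h v"]) (auto intro!: continuous_intros)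
qed

lemma sum_Collect_of_bool:
  fixes h :: "'r::finite \<Rightarrow> real"
  shows "(\<Sum>a | P a. h a) = (\<Sum>a\<in>UNIV. h a * of_bool (P a))"
  by (simp add: of_bool_def if_distrib sum.If_cases cong: if_cong)

lemma mass_at_alt: "mass_at x m v = (\<Sum>i\<in>UNIV. m $ i * of_bool (x i = v))"
  unfolding mass_at_def by (rule sum_Collect_of_bool)

text \<open>Weights between labels at the same two points are added, which cannot raise the cost by
  subadditivity. Loops created by collisions cancel by antisymmetry. Testing with a function that
  singles out \<open>v\<close> among the points of \<open>V\<close> recovers the balance at
  \<open>v\<close>.\<close>

lemma flow_of_labelled:
  fixes p :: "'a::euclidean_space^'r::finite"
  assumes \<alpha>: "0 \<le> \<alpha>" "\<alpha> \<le> 1" and L: "(m, p, w) \<in> labelled_flows X x y n"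
  defines "V \<equiv> range (\<lambda>a. p $ a) \<union> range x \<union> range y"
  obtains \<phi> where "flow_on V (net_mass x m y n) \<phi>" "flow_cost \<alpha> V \<phi> \<le> labelled_cost \<alpha> p w"
proof -
  note anti = labelled_flowsD(4)[OF L] and weak = labelled_flowsD(5)[OF L]
  have fin: "finite V" by (simp add: V_def)
  have pV: "p $ a \<in> V" "x i \<in> V" "y j \<in> V" for a i j by (auto simp: V_def)
  define \<phi> where "\<phi> u v = (\<Sum>a | p $ a = u. \<Sum>b | p $ b = v. w $ a $ b)" for u v
  have group: "(\<Sum>u\<in>V. \<Sum>a | p $ a = u. h a) = (\<Sum>a\<in>UNIV. h a)" for h :: "'r \<Rightarrow> real"
    using sum.group[of UNIV V "($) p" h] fin pV by auto
  have "flow_on V (net_mass x m y n) \<phi>"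
    unfolding flow_on_def
  proof (intro conjI allI impI ballI)
    show "\<phi> v u = - \<phi> u v" for u v
    proof -
      have "\<phi> v u = (\<Sum>b | p $ b = u. \<Sum>a | p $ a = v. w $ a $ b)"
        unfolding \<phi>_def by (rule sum.swap)
      also have "\<dots> = (\<Sum>b | p $ b = u. \<Sum>a | p $ a = v. - (w $ b $ a))"
        by (intro sum.cong refl anti)
      finally show ?thesis by (simp add: \<phi>_def sum_negf)
    qed
    show "u \<in> V" if "\<phi> u v \<noteq> 0" for u v
    proof (rule ccontr)
      assume "u \<notin> V"
      then have "{a. p $ a = u} = {}" using pV by blast
      then show False using that by (simp add: \<phi>_def)
    qed
    fix v assume "v \<in> V"
    obtain g :: "'a \<Rightarrow> real" where g: "continuous_on UNIV g" "\<And>u. u \<in> V \<Longrightarrow> g u = of_bool (u = v)"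
      using separating_function[OF fin] by blast
    have "(\<Sum>u\<in>V. \<phi> v u) = (\<Sum>a | p $ a = v. \<Sum>u\<in>V. \<Sum>b | p $ b = u. w $ a $ b)"
      unfolding \<phi>_def by (rule sum.swap)
    also have "\<dots> = (\<Sum>a | p $ a = v. \<Sum>b\<in>UNIV. w $ a $ b)" by (simp add: group)
    also have "\<dots> = (\<Sum>a\<in>UNIV. \<Sum>b\<in>UNIV. w $ a $ b * g (p $ a))"
      unfolding sum_Collect_of_bool by (simp only: g(2)[OF pV(1)] sum_distrib_right)
    also have "\<dots> = net_mass x m y n v"
      unfolding weak[OF g(1)] by (simp add: net_mass_def mass_at_alt g(2) pV)
    finally show "(\<Sum>u\<in>V. \<phi> v u) = net_mass x m y n v" .
  qed
  moreover have "flow_cost \<alpha> V \<phi> \<le> labelled_cost \<alpha> p w"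
  proof -
    let ?h = "\<lambda>a b. \<bar>w $ a $ b\<bar> powr \<alpha> * dist (p $ a) (p $ b)"
    have "flow_cost \<alpha> V \<phi> \<le> (\<Sum>u\<in>V. \<Sum>v\<in>V. \<Sum>a | p $ a = u. \<Sum>b | p $ b = v. ?h a b)"
      unfolding flow_cost_def
    proof (intro sum_mono)
      fix u v
      have "\<bar>\<phi> u v\<bar> powr \<alpha> \<le> (\<Sum>a | p $ a = u. \<Sum>b | p $ b = v. \<bar>w $ a $ b\<bar> powr \<alpha>)"
        unfolding \<phi>_def
        by (rule order_trans[OF powr_sum_subadditive[OF \<alpha>] sum_mono[OF powr_sum_subadditive[OF \<alpha>]]])
      then have "\<bar>\<phi> u v\<bar> powr \<alpha> * dist u v
        \<le> (\<Sum>a | p $ a = u. \<Sum>b | p $ b = v. \<bar>w $ a $ b\<bar> powr \<alpha>) * dist u v"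
        by (intro mult_right_mono) auto
      then show "\<bar>\<phi> u v\<bar> powr \<alpha> * dist u v \<le> (\<Sum>a | p $ a = u. \<Sum>b | p $ b = v. ?h a b)"
        by (simp add: sum_distrib_right)
    qed
    also have "\<dots> = (\<Sum>u\<in>V. \<Sum>a | p $ a = u. \<Sum>v\<in>V. \<Sum>b | p $ b = v. ?h a b)"
      by (rule sum.cong[OF refl], rule sum.swap)
    also have "\<dots> = labelled_cost \<alpha> p w" by (simp only: group labelled_cost_def)
    finally show ?thesis .
  qed
  ultimately show thesis using that by blast
qed

lemma labelled_of_flow:
  fixes x :: "'k::finite \<Rightarrow> 'a::euclidean_space" and y :: "'l::finite \<Rightarrow> 'a"
  assumes V: "finite V" "V \<subseteq> X" "range x \<union> range y \<subseteq> V" "card V \<le> CARD('r::finite)"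
    and flow: "flow_on V (net_mass x m y n) \<phi>" and le: "\<And>u v. \<bar>\<phi> u v\<bar> \<le> 1" and m: "m \<in> mass_vectors"
  obtains p and w :: "real^'r^'r" where
    "(m, p, w) \<in> labelled_flows X x y n" "labelled_cost \<alpha> p w = flow_cost \<alpha> V \<phi>"
proof -
  note D = flow_onD[OF flow]
  obtain \<sigma> where \<sigma>: "inj_on \<sigma> V" "\<sigma> ` V \<subseteq> (UNIV :: 'r set)"
    using card_le_inj[of V "UNIV :: 'r set"] V by auto
  define \<tau> where "\<tau> = inv_into V \<sigma>"
  have \<tau>: "\<tau> (\<sigma> v) = v" if "v \<in> V" for v using \<sigma>(1) that by (simp add: \<tau>_def)
  \<comment> \<open>Surplus labels need a position in \<open>X\<close>; they are all put at
    \<open>v0\<close> and given weight 0.\<close>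
  obtain v0 where v0: "v0 \<in> V" using V(3) by auto
  define p :: "'a^'r" where "p = (\<chi> a. if a \<in> \<sigma> ` V then \<tau> a else v0)"
  define w :: "real^'r^'r" where "w = (\<chi> a b. if a \<in> \<sigma> ` V \<and> b \<in> \<sigma> ` V then \<phi> (\<tau> a) (\<tau> b) else 0)"
  have pV: "p $ a \<in> V" for a using v0 \<tau> by (auto simp: p_def)
  have relabel: "(\<Sum>a\<in>UNIV. \<Sum>b\<in>UNIV. if a \<in> \<sigma> ` V \<and> b \<in> \<sigma> ` V then h (\<tau> a) (\<tau> b) else 0)
      = (\<Sum>u\<in>V. \<Sum>v\<in>V. h u v)" for h :: "'a \<Rightarrow> 'a \<Rightarrow> real"
  proof -
    have "(\<Sum>a\<in>UNIV. \<Sum>b\<in>UNIV. if a \<in> \<sigma> ` V \<and> b \<in> \<sigma> ` V then h (\<tau> a) (\<tau> b) else 0)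
      = (\<Sum>a\<in>\<sigma> ` V. \<Sum>b\<in>\<sigma> ` V. h (\<tau> a) (\<tau> b))"
      unfolding sum.cartesian_product by (rule sum.mono_neutral_cong_right) (auto split: if_splits)
    then show ?thesis by (simp add: sum.reindex[OF \<sigma>(1)] \<tau>)
  qed
  have "(m, p, w) \<in> labelled_flows X x y n"
    unfolding labelled_flows_def mem_Collect_eq fst_conv snd_conv
  proof (intro conjI allI impI)
    show "p $ a \<in> X" for a using pV V(2) by blast
    show "\<bar>w $ a $ b\<bar> \<le> 1" for a b using le by (simp add: w_def)
    show "w $ b $ a = - (w $ a $ b)" for a b using D(1)[of "\<tau> b" "\<tau> a"] by (simp add: w_def)
    fix g :: "'a \<Rightarrow> real"
    have "(\<Sum>a\<in>UNIV. \<Sum>b\<in>UNIV. w $ a $ b * g (p $ a))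
      = (\<Sum>a\<in>UNIV. \<Sum>b\<in>UNIV. if a \<in> \<sigma> ` V \<and> b \<in> \<sigma> ` V then \<phi> (\<tau> a) (\<tau> b) * g (\<tau> a) else 0)"
      by (intro sum.cong) (auto simp: w_def p_def)
    also have "\<dots> = (\<Sum>u\<in>V. \<Sum>v\<in>V. \<phi> u v * g u)" by (rule relabel)
    also have "\<dots> = (\<Sum>u\<in>V. net_mass x m y n u * g u)"
      by (simp add: D(4) flip: sum_distrib_right)
    also have "\<dots> = (\<Sum>i\<in>UNIV. m $ i * g (x i)) - (\<Sum>j\<in>UNIV. n $ j * g (y j))"
      using V(1,3) by (simp add: net_mass_def left_diff_distrib sum_subtractf sum_mass_at)
    finally show "(\<Sum>a\<in>UNIV. \<Sum>b\<in>UNIV. w $ a $ b * g (p $ a))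
      = (\<Sum>i\<in>UNIV. m $ i * g (x i)) - (\<Sum>j\<in>UNIV. n $ j * g (y j))" .
  qed (rule m)
  moreover have "labelled_cost \<alpha> p w = flow_cost \<alpha> V \<phi>"
  proof -
    have "labelled_cost \<alpha> p w = (\<Sum>a\<in>UNIV. \<Sum>b\<in>UNIV. if a \<in> \<sigma> ` V \<and> b \<in> \<sigma> ` V
        then \<bar>\<phi> (\<tau> a) (\<tau> b)\<bar> powr \<alpha> * dist (\<tau> a) (\<tau> b) else 0)"
      unfolding labelled_cost_def by (intro sum.cong) (auto simp: w_def p_def)
    also have "\<dots> = flow_cost \<alpha> V \<phi>" unfolding flow_cost_def by (rule relabel)
    finally show ?thesis .
  qed
  ultimately show thesis using that by blast
qed

section \<open>Existence of an optimal transport path\<close>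

lemma transport_path_of_flow:
  assumes \<alpha>: "0 \<le> \<alpha>" "\<alpha> \<le> 1" and fin: "finite V" and flow: "flow_on V (net_mass x m y n) \<phi>"
    and V: "V \<subseteq> X" "range x \<union> range y \<subseteq> V"
  obtains G where "G \<in> transport_paths X x m y n" "2 * M_cost \<alpha> G \<le> flow_cost \<alpha> V \<phi>"
proof -
  obtain \<psi> where \<psi>: "flow_on V (net_mass x m y n) \<psi>" "flow_cost \<alpha> V \<psi> \<le> flow_cost \<alpha> V \<phi>"
    "\<not> has_circuit (\<lambda>u v. \<psi> u v \<noteq> 0)"
    \<comment> \<open>The given flow may contain circuits, for instance after collisions in a limit,
      so it is reduced before being read as a graph.\<close>
    by (rule minimal_flow[OF \<alpha> fin flow]) (erule (2) that)
  from graph_of_flow_transport_path[OF fin \<psi>(1,3) V] that[of "graph_of_flow V \<psi>"] \<psi>(2)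
  show thesis by metis
qed

text \<open>A star: all mass starts at one point \<open>x i\<close> and runs straight to each
  \<open>y j\<close>. This provides a first competitor; without one the infimum would not be
  finite.\<close>

lemma transport_path_exists:
  fixes x :: "'k::finite \<Rightarrow> 'a::metric_space" and y :: "'l::finite \<Rightarrow> 'a"
  assumes X: "range x \<union> range y \<subseteq> X" and n: "(\<Sum>j\<in>UNIV. n $ j) = 1"
  obtains m G where "m \<in> mass_vectors" "G \<in> transport_paths X x m y n"
proof -
  fix i :: 'k
  let ?V = "range x \<union> range y"
  define m :: "real^'k" where "m = axis i 1"
  have flow: "flow_on ?V (\<lambda>v. \<Sum>j\<in>J. n $ j * (of_bool (v = x i) - of_bool (v = y j)))
      (\<lambda>u v. \<Sum>j\<in>J. n $ j * walk_flow [x i, y j] u v)" for J :: "'l set"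
  proof (induction J rule: infinite_finite_induct)
    case (insert j J)
    have "flow_on ?V (\<lambda>v. of_bool (v = x i) - of_bool (v = y j)) (walk_flow [x i, y j])"
      using flow_on_walk_flow[of ?V "[x i, y j]"] by simp
    from flow_on_add_scaled[OF insert.IH this, of "n $ j"] insert.hyps show ?case
      by (simp add: add.commute)
  qed (simp_all add: flow_on_def)
  have "mass_at x m v = of_bool (v = x i)" for v
    by (auto simp: m_def mass_at_alt axis_def of_bool_def if_distrib[of "\<lambda>t. t * _"] cong: if_cong)
  then have "(\<lambda>v. \<Sum>j\<in>UNIV. n $ j * (of_bool (v = x i) - of_bool (v = y j))) = net_mass x m y n"
    using n by (auto simp: fun_eq_iff net_mass_def mass_at_alt right_diff_distrib sum_subtractf
        eq_commute[of _ "y _"] simp flip: sum_distrib_right)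
  with flow[of UNIV] have "flow_on ?V (net_mass x m y n) (\<lambda>u v. \<Sum>j\<in>UNIV. n $ j * walk_flow [x i, y j] u v)"
    by simp
  then obtain G where "G \<in> transport_paths X x m y n"
    \<comment> \<open>Only existence matters, so the exponent 0 is as good as any.\<close>
    by (rule transport_path_of_flow[of 0, rotated 3]) (use X in auto)
  moreover have "m \<in> mass_vectors" by (auto simp: m_def mass_vectors_def axis_def)
  ultimately show thesis using that by blast
qed

lemma optimal_transport_path_exists:
  fixes x :: "'k::finite \<Rightarrow> 'a::euclidean_space" and y :: "'l::finite \<Rightarrow> 'a"
  assumes \<alpha>: "0 \<le> \<alpha>" "\<alpha> \<le> 1" and X: "compact X" "range x \<union> range y \<subseteq> X"
    and n: "\<And>j. 0 \<le> n $ j" "(\<Sum>j\<in>UNIV. n $ j) = 1"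
  obtains m G where "m \<in> mass_vectors" "G \<in> transport_paths X x m y n"
    "\<And>m' G'. m' \<in> mass_vectors \<Longrightarrow> G' \<in> transport_paths X x m' y n \<Longrightarrow> M_cost \<alpha> G \<le> M_cost \<alpha> G'"
proof -
  \<comment> \<open>The label type has exactly \<open>4 * (CARD('k) + CARD('l))\<close> elements,
    the vertex bound of \<open>bounded_flow_exists\<close>.\<close>
  let ?L = "labelled_flows X x y n ::
    ((real^'k) \<times> ('a^(('k + 'l) \<times> bool \<times> bool)) \<times> (real^(('k + 'l) \<times> bool \<times> bool)^(('k + 'l) \<times> bool \<times> bool))) set"
  \<comment> \<open>Every transport path is matched by a labelled flow of at most twice its cost.
    Conversely the optimal labelled flow yields a transport path of at most half its cost, so the
    factors cancel.\<close>
  have lab: "\<exists>p w. (m', p, w) \<in> ?L \<and> labelled_cost \<alpha> p w \<le> 2 * M_cost \<alpha> G'"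
    if G': "G' \<in> transport_paths X x m' y n" and m': "m' \<in> mass_vectors" for m' G'
  proof -
    obtain V \<phi> where V: "finite V" "V \<subseteq> X" "range x \<union> range y \<subseteq> V"
      "card V \<le> 4 * (CARD('k) + CARD('l))" "flow_on V (net_mass x m' y n) \<phi>"
      "\<And>u v. \<bar>\<phi> u v\<bar> \<le> 1" "flow_cost \<alpha> V \<phi> \<le> 2 * M_cost \<alpha> G'"
      using bounded_flow_exists[OF \<alpha> G' m' n(1)] by metis
    have "card V \<le> CARD(('k + 'l) \<times> bool \<times> bool)"
      using V(4) by (simp add: card_UNIV_sum)
    from labelled_of_flow[OF V(1-3) this V(5,6) m', of \<alpha>] V(7) show ?thesis by metis
  qed
  have "?L \<noteq> {}"
    using transport_path_exists[OF X(2) n(2)] lab by (metis empty_iff)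
  from labelled_minimum[OF X(1) this] obtain m p w where L: "(m, p, w) \<in> ?L"
    and min: "\<And>m' p' w'. (m', p', w') \<in> ?L \<Longrightarrow> labelled_cost \<alpha> p w \<le> labelled_cost \<alpha> p' w'" by metis
  let ?V = "range (\<lambda>a. p $ a) \<union> range x \<union> range y"
  obtain \<phi> where \<phi>: "flow_on ?V (net_mass x m y n) \<phi>" "flow_cost \<alpha> ?V \<phi> \<le> labelled_cost \<alpha> p w"
    using flow_of_labelled[OF \<alpha> L] by blast
  have "?V \<subseteq> X" using X(2) labelled_flowsD(2)[OF L] by auto
  then obtain G where G: "G \<in> transport_paths X x m y n" "2 * M_cost \<alpha> G \<le> flow_cost \<alpha> ?V \<phi>"
    using transport_path_of_flow[OF \<alpha> _ \<phi>(1), of X] by auto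
  have "M_cost \<alpha> G \<le> M_cost \<alpha> G'"
    if m': "m' \<in> mass_vectors" and G': "G' \<in> transport_paths X x m' y n" for m' G'
  proof -
    obtain p' w' where "(m', p', w') \<in> ?L" "labelled_cost \<alpha> p' w' \<le> 2 * M_cost \<alpha> G'"
      using lab[OF G' m'] by blast
    then show ?thesis using min[of m' p' w'] G(2) \<phi>(2) by simp
  qed
  moreover have "m \<in> mass_vectors" by (rule labelled_flowsD(1)[OF L])
  ultimately show thesis using that G(1) by blast
qed

theorem proposition3p1:
  fixes \<alpha> :: real
    and X :: "(real^'d::finite) set"
    and x :: "'k::finite \<Rightarrow> real^'d"
    and y :: "'l::finite \<Rightarrow> real^'d"
    and n :: "real^'l"
  assumes "0 \<le> \<alpha>" and "\<alpha> < 1"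
    and "compact X" and "convex X"
    and "inj x" and "\<And>i. x i \<in> X"
    and "\<And>j. y j \<in> X"
    and "\<And>j. 0 < n $ j" and "(\<Sum>j\<in>UNIV. n $ j) = 1"
  shows
    "(\<exists>q\<in>allocation_plans n.
        (\<exists>G\<in>compatible_paths X x y n q. T_cost \<alpha> X x y n q = ereal (M_cost \<alpha> G)) \<and>
        (\<forall>q'\<in>allocation_plans n. T_cost \<alpha> X x y n q \<le> T_cost \<alpha> X x y n q')) \<and>
     (\<exists>m\<in>mass_vectors.
        (\<exists>G\<in>transport_paths X x m y n. d_cost \<alpha> X x m y n = ereal (M_cost \<alpha> G)) \<and>
        (\<forall>m'\<in>mass_vectors. d_cost \<alpha> X x m y n \<le> d_cost \<alpha> X x m' y n)) \<and>
     (INF q\<in>allocation_plans n. T_cost \<alpha> X x y n q)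
       = (INF m\<in>mass_vectors. d_cost \<alpha> X x m y n)"
proof -
  have n: "0 \<le> n $ j" for j using assms(8) by (simp add: less_imp_le)
  have X: "range x \<union> range y \<subseteq> X" using assms(6,7) by auto
  have \<alpha>: "\<alpha> \<le> 1" using assms(2) by simp
  obtain m G where m: "m \<in> mass_vectors" and G: "G \<in> transport_paths X x m y n"
    and min: "\<And>m' G'. m' \<in> mass_vectors \<Longrightarrow> G' \<in> transport_paths X x m' y n \<Longrightarrow> M_cost \<alpha> G \<le> M_cost \<alpha> G'"
    using optimal_transport_path_exists[OF assms(1) \<alpha> assms(3) X n assms(9)] by blast
  obtain q where q: "q \<in> allocation_plans n" "source_masses q = m" "compatible x y G q"
    using compatible_plan_exists[OF G m n] by blast
  have Gq: "G \<in> compatible_paths X x y n q" using G q by (simp add: compatible_paths_def)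
  have d_ge: "ereal (M_cost \<alpha> G) \<le> d_cost \<alpha> X x m' y n" if "m' \<in> mass_vectors" for m'
    unfolding d_cost_def using min[OF that] by (intro INF_greatest) simp
  \<comment> \<open>Each compatible path for \<open>q'\<close> is a transport path from
    \<open>source_masses q'\<close>, hence a competitor in the joint minimization. Since
    \<open>G\<close> is itself compatible with \<open>q\<close>, the same number is attained on both
    sides.\<close>
  have T_ge: "ereal (M_cost \<alpha> G) \<le> T_cost \<alpha> X x y n q'" if "q' \<in> allocation_plans n" for q'
    unfolding T_cost_def using min[OF source_masses_in_mass_vectors[OF that assms(9)]]
    by (intro INF_greatest) (simp add: compatible_paths_def)
  have d: "d_cost \<alpha> X x m y n = ereal (M_cost \<alpha> G)"
    using d_ge[OF m] G unfolding d_cost_def by (intro antisym INF_lower)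
  have T: "T_cost \<alpha> X x y n q = ereal (M_cost \<alpha> G)"
    using T_ge[OF q(1)] Gq unfolding T_cost_def by (intro antisym INF_lower)
  have "(INF q\<in>allocation_plans n. T_cost \<alpha> X x y n q) = ereal (M_cost \<alpha> G)"
    using T_ge q(1) T by (intro antisym INF_greatest) (auto intro: INF_lower2)
  moreover have "(INF m\<in>mass_vectors. d_cost \<alpha> X x m y n) = ereal (M_cost \<alpha> G)"
    using d_ge m d by (intro antisym INF_greatest) (auto intro: INF_lower2)
  ultimately show ?thesis using m G d d_ge q(1) Gq T T_ge by metis
qed

end
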